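(* The set of all $g_{\mathrm{i}s,\pi_r}$ and all $f_{z,\pi}$ generates the group $\Lambda^{\tau,\sigma}_{-,m}(n)$, where $s\in\mathbb{R}\setminus\{0\}$, $z\in\mathbb{C}\setminus(\mathbb{R}\cup\mathrm{i}\mathbb{R})$, $\pi_r$ and $\pi$ are Hermitian projections of $\mathbb{C}^n$, and $\bar\pi_r=\pi_r$.
   Context: A Hermitian projection of $\mathbb{C}^n$ is a matrix $\pi$ with $\pi^2=\pi=\pi^*$ (including $\pi=0$ and $\pi=\mathrm{I}$); $\pi^\perp=\mathrm{I}-\pi$, $\mathrm{Im}\,\pi$ is its image, and $\bar\pi$ its entrywise complex conjugate. For $z\in\mathbb{C}\setminus\mathbb{R}$ and a Hermitian projection $\pi$, $$g_{z,\pi}(\lambda)=\pi+\frac{\lambda-\bar z}{\lambda-z}\,\pi^\perp .$$ For $z\in\mathbb{C}\setminus(\mathbb{R}\cup\mathrm{i}\mathbb{R})$, $f_{z,\pi}:=g_{-\bar z,\rho}\,g_{z,\pi}$, where $\rho$ is the Hermitian projection onto $g_{z,\pi}(-\bar z)(\mathrm{Im}\,\bar\pi)$. $\Lambda^{\tau,\sigma}_{-,m}(n)$ is the group of rational maps $g$ from $\mathbb{C}\cup\{\infty\}$ to $GL(n,\mathbb{C})$ (matrices of rational functions of $\lambda$, not identically singular, regular at $\infty$) with $g(\infty)=\mathrm{I}$ satisfying $g(\bar\lambda)^*g(\lambda)=\mathrm{I}$ and $g(-\lambda)^tg(\lambda)=\mathrm{I}$. *)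

theory Defs
  imports
    "HOL-Analysis.Analysis"
    "HOL-Algebra.Generated_Groups"
    "HOL-Computational_Algebra.Computational_Algebra"
    "HOL-Computational_Algebra.Field_as_Ring"
begin

section \<open>Rational functions of one complex variable\<close>

text \<open>
  A rational function is an element of the fraction field of \<open>complex poly\<close>; \<^const>\<open>quot_of_fract\<close>
  yields its numerator and denominator in lowest terms.
\<close>

type_synonym ratfun = "complex poly fract"

definition rf_num :: "ratfun \<Rightarrow> complex poly" where
  "rf_num r = fst (quot_of_fract r)"

definition rf_den :: "ratfun \<Rightarrow> complex poly" where
  "rf_den r = snd (quot_of_fract r)"

definition rf_regular :: "ratfun \<Rightarrow> complex \<Rightarrow> bool" where
  "rf_regular r a \<longleftrightarrow> poly (rf_den r) a \<noteq> 0"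

text \<open>The value at a point (meaningful only where \<open>r\<close> is regular).\<close>
definition rf_eval :: "ratfun \<Rightarrow> complex \<Rightarrow> complex" where
  "rf_eval r a = poly (rf_num r) a / poly (rf_den r) a"

definition rf_regular_inf :: "ratfun \<Rightarrow> bool" where
  "rf_regular_inf r \<longleftrightarrow> degree (rf_num r) \<le> degree (rf_den r)"

text \<open>The value at infinity (meaningful only if \<open>r\<close> is regular there).\<close>
definition rf_eval_inf :: "ratfun \<Rightarrow> complex" where
  "rf_eval_inf r = coeff (rf_num r) (degree (rf_den r)) / lead_coeff (rf_den r)"

definition rf_const :: "complex \<Rightarrow> ratfun" where
  "rf_const c = to_fract [:c:]"


section \<open>Matrices of rational functions\<close>

definition rfm_regular :: "ratfun^'n^'n \<Rightarrow> complex \<Rightarrow> bool" where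
  "rfm_regular g a \<longleftrightarrow> (\<forall>i j. rf_regular (g $ i $ j) a)"

definition rfm_eval :: "ratfun^'n^'n \<Rightarrow> complex \<Rightarrow> complex^'n^'n" where
  "rfm_eval g a = map_matrix (\<lambda>r. rf_eval r a) g"

definition rfm_regular_inf :: "ratfun^'n^'n \<Rightarrow> bool" where
  "rfm_regular_inf g \<longleftrightarrow> (\<forall>i j. rf_regular_inf (g $ i $ j))"

definition rfm_eval_inf :: "ratfun^'n^'n \<Rightarrow> complex^'n^'n" where
  "rfm_eval_inf g = map_matrix rf_eval_inf g"

definition cnj_matrix :: "complex^'n^'m \<Rightarrow> complex^'n^'m" where
  "cnj_matrix A = map_matrix cnj A"

definition conj_transpose :: "complex^'n^'m \<Rightarrow> complex^'m^'n" where
  "conj_transpose A = transpose (cnj_matrix A)"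


section \<open>The group of rational maps\<close>

text \<open>
  The two symmetry conditions are identities between rational functions; they are required at
  every \<open>\<lambda>\<close> at which both factors are regular, that is, at all but finitely many \<open>\<lambda>\<close>.
\<close>

definition rational_loops :: "(ratfun^'n^'n) set" where
  "rational_loops = {g.
     det g \<noteq> 0 \<and>
     rfm_regular_inf g \<and> rfm_eval_inf g = mat 1 \<and>
     (\<forall>l. rfm_regular g (cnj l) \<and> rfm_regular g l \<longrightarrow>
        conj_transpose (rfm_eval g (cnj l)) ** rfm_eval g l = mat 1) \<and>
     (\<forall>l. rfm_regular g (- l) \<and> rfm_regular g l \<longrightarrow>
        transpose (rfm_eval g (- l)) ** rfm_eval g l = mat 1)}"

definition Lambda_group :: "(ratfun^'n^'n) monoid" where
  "Lambda_group = \<lparr>carrier = rational_loops, mult = (**), one = mat 1\<rparr>"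


section \<open>Simple elements\<close>

definition hermitian_projection :: "complex^'n^'n \<Rightarrow> bool" where
  "hermitian_projection P \<longleftrightarrow> P ** P = P \<and> conj_transpose P = P"

definition matrix_image :: "complex^'n^'n \<Rightarrow> (complex^'n) set" where
  "matrix_image A = range (\<lambda>v. A *v v)"

definition projection_onto :: "(complex^'n) set \<Rightarrow> complex^'n^'n" where
  "projection_onto W = (THE P. hermitian_projection P \<and> matrix_image P = W)"

definition g_factor :: "complex \<Rightarrow> complex^'n^'n \<Rightarrow> ratfun^'n^'n" where
  "g_factor z P = (\<chi> i j. rf_const (P $ i $ j) +
     Fract [:- cnj z, 1:] [:- z, 1:] * rf_const ((mat 1 - P) $ i $ j))"

definition f_rho :: "complex \<Rightarrow> complex^'n^'n \<Rightarrow> complex^'n^'n" where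
  "f_rho z P = projection_onto
     ((\<lambda>v. rfm_eval (g_factor z P) (- cnj z) *v v) ` matrix_image (cnj_matrix P))"

definition f_factor :: "complex \<Rightarrow> complex^'n^'n \<Rightarrow> ratfun^'n^'n" where
  "f_factor z P = g_factor (- cnj z) (f_rho z P) ** g_factor z P"

section \<open>Evaluation of rational functions, and the group property\<close>


lemma rf_den_nonzero [simp]: "rf_den r \<noteq> 0"
  by (simp add: rf_den_def)

lemma Fract_rf [simp]: "Fract (rf_num r) (rf_den r) = r"
  by (simp add: rf_num_def rf_den_def)

lemma Fract_reduce:
  assumes "q \<noteq> 0"
  obtains u v d where "rf_num (Fract p q) = u" "rf_den (Fract p q) = v"
    "p = u * d" "q = v * d" "d \<noteq> 0"
proof -
  have *: "quot_of_fract (Fract p q) = normalize_quot (p, q)"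
    using quot_of_fract_quot_to_fract[of "(p, q)"] by (simp add: quot_to_fract_def)
  show ?thesis
    by (rule normalize_quotE[OF assms, of p], rule that)
       (simp_all only: rf_num_def rf_den_def *)
qed

lemma rf_Fract:
  assumes "poly q a \<noteq> 0"
  shows rf_regular_Fract: "rf_regular (Fract p q) a"
    and rf_eval_Fract: "rf_eval (Fract p q) a = poly p a / poly q a"
proof -
  have "q \<noteq> 0" using assms by auto
  then obtain u v d where uv: "rf_num (Fract p q) = u" "rf_den (Fract p q) = v"
    and pq: "p = u * d" "q = v * d" and "d \<noteq> 0"
    by (rule Fract_reduce)
  have nz: "poly v a \<noteq> 0" "poly d a \<noteq> 0" using assms by (auto simp: pq)
  show "rf_regular (Fract p q) a"
    unfolding rf_regular_def uv by (rule nz)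
  show "rf_eval (Fract p q) a = poly p a / poly q a"
    unfolding rf_eval_def uv using nz by (simp add: pq)
qed

lemma rf_inf_Fract:
  assumes "q \<noteq> 0" "degree p \<le> degree q"
  shows rf_regular_inf_Fract: "rf_regular_inf (Fract p q)"
    and rf_eval_inf_Fract: "rf_eval_inf (Fract p q) = coeff p (degree q) / lead_coeff q"
proof -
  obtain u v d where uv: "rf_num (Fract p q) = u" "rf_den (Fract p q) = v"
    and pq: "p = u * d" "q = v * d" and d: "d \<noteq> 0"
    using assms(1) by (rule Fract_reduce)
  have v: "v \<noteq> 0" using assms(1) pq by auto
  have deg: "degree u \<le> degree v"
  proof (cases "u = 0")
    case False
    then show ?thesis using assms(2) v d by (simp add: pq degree_mult_eq)
  qed simp
  then show "rf_regular_inf (Fract p q)"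
    by (simp add: rf_regular_inf_def uv)
  have "coeff (u * d) (degree v + degree d) = coeff u (degree v) * lead_coeff d"
  proof (cases "degree u = degree v")
    case True
    then show ?thesis using coeff_mult_degree_sum[of u d] by simp
  next
    case False
    then have "degree u < degree v" using deg by simp
    then have "degree (u * d) < degree v + degree d"
      using degree_mult_le[of u d] by linarith
    then show ?thesis using \<open>degree u < degree v\<close> by (simp add: coeff_eq_0)
  qed
  moreover have "degree q = degree v + degree d" using v d by (simp add: pq degree_mult_eq)
  moreover have "lead_coeff q = lead_coeff v * lead_coeff d" by (simp add: pq lead_coeff_mult)
  ultimately show "rf_eval_inf (Fract p q) = coeff p (degree q) / lead_coeff q"
    unfolding rf_eval_inf_def uv using d by (simp add: pq lead_coeff_mult)
qed

lemma rf_const [simp]: "rf_regular (rf_const c) a" "rf_eval (rf_const c) a = c"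
    "rf_regular_inf (rf_const c)" "rf_eval_inf (rf_const c) = c"
  using rf_Fract[of 1 a "[:c:]"] rf_inf_Fract[of 1 "[:c:]"]
  by (simp_all add: rf_const_def to_fract_def)

lemma rf_const_01: "rf_const 0 = 0" "rf_const 1 = 1"
  by (simp_all add: rf_const_def to_fract_def Zero_fract_def One_fract_def one_pCons)

lemmas rf_01 [simp] = rf_const[of 0, unfolded rf_const_01] rf_const[of 1, unfolded rf_const_01]

lemma rf_mult:
  assumes "rf_regular r a" "rf_regular s a"
  shows "rf_regular (r * s) a \<and> rf_eval (r * s) a = rf_eval r a * rf_eval s a"
proof -
  have "r * s = Fract (rf_num r * rf_num s) (rf_den r * rf_den s)"
    by (metis Fract_rf mult_fract)
  then show ?thesis
    using assms rf_Fract[of "rf_den r * rf_den s" a "rf_num r * rf_num s"]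
    by (simp add: rf_regular_def rf_eval_def)
qed

lemma rf_add:
  assumes "rf_regular r a" "rf_regular s a"
  shows "rf_regular (r + s) a \<and> rf_eval (r + s) a = rf_eval r a + rf_eval s a"
proof -
  have "r + s = Fract (rf_num r * rf_den s + rf_num s * rf_den r) (rf_den r * rf_den s)"
    by (metis Fract_rf add_fract rf_den_nonzero)
  then show ?thesis
    using assms rf_Fract[of "rf_den r * rf_den s" a "rf_num r * rf_den s + rf_num s * rf_den r"]
    by (simp add: rf_regular_def rf_eval_def add_frac_eq)
qed

lemma coeff_mult_bound:
  fixes p q :: "complex poly"
  assumes "degree p \<le> m" "degree q \<le> n"
  shows "coeff (p * q) (m + n) = coeff p m * coeff q n"
proof (cases "degree p = m \<and> degree q = n")
  case True
  then show ?thesis using coeff_mult_degree_sum[of p q] by auto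
next
  case False
  then have "degree (p * q) < m + n" and *: "degree p < m \<or> degree q < n"
    using assms degree_mult_le[of p q] by linarith+
  then show ?thesis by (auto simp: coeff_eq_0)
qed

lemma rf_mult_inf:
  assumes "rf_regular_inf r" "rf_regular_inf s"
  shows "rf_regular_inf (r * s) \<and> rf_eval_inf (r * s) = rf_eval_inf r * rf_eval_inf s"
proof -
  have e: "r * s = Fract (rf_num r * rf_num s) (rf_den r * rf_den s)"
    by (metis Fract_rf mult_fract)
  have d: "degree (rf_den r * rf_den s) = degree (rf_den r) + degree (rf_den s)"
    by (simp add: degree_mult_eq)
  have "degree (rf_num r * rf_num s) \<le> degree (rf_den r * rf_den s)"
    using assms degree_mult_le[of "rf_num r" "rf_num s"] by (simp add: rf_regular_inf_def d)
  then show ?thesis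
    using assms rf_inf_Fract[of "rf_den r * rf_den s" "rf_num r * rf_num s"]
    by (simp add: e rf_eval_inf_def rf_regular_inf_def d coeff_mult_bound)
qed

lemma rf_add_inf:
  assumes "rf_regular_inf r" "rf_regular_inf s"
  shows "rf_regular_inf (r + s) \<and> rf_eval_inf (r + s) = rf_eval_inf r + rf_eval_inf s"
proof -
  have e: "r + s = Fract (rf_num r * rf_den s + rf_den r * rf_num s) (rf_den r * rf_den s)"
    by (metis Fract_rf add_fract rf_den_nonzero mult.commute)
  have d: "degree (rf_den r * rf_den s) = degree (rf_den r) + degree (rf_den s)"
    by (simp add: degree_mult_eq)
  have "degree (rf_num r * rf_den s + rf_den r * rf_num s) \<le> degree (rf_den r * rf_den s)"
  proof (rule degree_add_le)
    show "degree (rf_num r * rf_den s) \<le> degree (rf_den r * rf_den s)"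
      using assms(1) degree_mult_le[of "rf_num r" "rf_den s"] unfolding rf_regular_inf_def d by linarith
    show "degree (rf_den r * rf_num s) \<le> degree (rf_den r * rf_den s)"
      using assms(2) degree_mult_le[of "rf_den r" "rf_num s"] unfolding rf_regular_inf_def d by linarith
  qed
  then have "rf_regular_inf (r + s)"
      "rf_eval_inf (r + s) = coeff (rf_num r * rf_den s + rf_den r * rf_num s) (degree (rf_den r * rf_den s)) /
         lead_coeff (rf_den r * rf_den s)"
    unfolding e by (intro rf_inf_Fract; simp)+
  moreover have "coeff (rf_num r * rf_den s) (degree (rf_den r * rf_den s)) =
      coeff (rf_num r) (degree (rf_den r)) * lead_coeff (rf_den s)"
    using assms(1) unfolding d rf_regular_inf_def by (intro coeff_mult_bound) auto
  moreover have "coeff (rf_den r * rf_num s) (degree (rf_den r * rf_den s)) =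
      lead_coeff (rf_den r) * coeff (rf_num s) (degree (rf_den s))"
    using assms(2) unfolding d rf_regular_inf_def by (intro coeff_mult_bound) auto
  ultimately show ?thesis
    by (simp add: rf_eval_inf_def lead_coeff_mult add_divide_distrib)
qed

lemma rf_sum:
  assumes "\<And>k. k \<in> A \<Longrightarrow> rf_regular (f k) a"
  shows "rf_regular (sum f A) a \<and> rf_eval (sum f A) a = (\<Sum>k\<in>A. rf_eval (f k) a)"
  using assms by (induction A rule: infinite_finite_induct) (auto simp: rf_add)

lemma rf_sum_inf:
  assumes "\<And>k. k \<in> A \<Longrightarrow> rf_regular_inf (f k)"
  shows "rf_regular_inf (sum f A) \<and> rf_eval_inf (sum f A) = (\<Sum>k\<in>A. rf_eval_inf (f k))"
  using assms by (induction A rule: infinite_finite_induct) (auto simp: rf_add_inf)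

lemma rf_finite_poles: "finite {a. \<not> rf_regular r a}"
  by (simp add: rf_regular_def poly_roots_finite)

lemma rf_isCont: "rf_regular r a \<Longrightarrow> isCont (rf_eval r) a"
  unfolding rf_eval_def[abs_def] rf_regular_def by (intro continuous_intros) auto

lemma rf_eqI:
  assumes "finite S" "\<And>a. a \<notin> S \<Longrightarrow> rf_regular r a \<Longrightarrow> rf_regular s a \<Longrightarrow> rf_eval r a = rf_eval s a"
  shows "r = s"
proof -
  define p where "p = rf_num r * rf_den s - rf_num s * rf_den r"
  have "UNIV \<subseteq> S \<union> {a. \<not> rf_regular r a} \<union> {a. \<not> rf_regular s a} \<union> {a. poly p a = 0}"
    using assms(2) by (auto simp: p_def rf_eval_def rf_regular_def field_simps)
  then have "infinite {a. poly p a = 0}"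
    using assms(1) rf_finite_poles by (metis finite_Un infinite_UNIV_char_0 finite_subset)
  then have "p = 0" using poly_roots_finite by blast
  then have "Fract (rf_num r) (rf_den r) = Fract (rf_num s) (rf_den s)"
    by (simp add: p_def eq_fract del: Fract_rf)
  then show ?thesis by simp
qed

lemma rfm_mult:
  assumes "rfm_regular g a" "rfm_regular h a"
  shows "rfm_regular (g ** h) a \<and> rfm_eval (g ** h) a = rfm_eval g a ** rfm_eval h a"
  using assms
  by (auto simp: rfm_regular_def rfm_eval_def matrix_matrix_mult_def vec_eq_iff rf_sum rf_mult)

lemma rfm_mult_inf:
  assumes "rfm_regular_inf g" "rfm_regular_inf h"
  shows "rfm_regular_inf (g ** h) \<and> rfm_eval_inf (g ** h) = rfm_eval_inf g ** rfm_eval_inf h"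
  using assms
  by (auto simp: rfm_regular_inf_def rfm_eval_inf_def matrix_matrix_mult_def vec_eq_iff
      rf_sum_inf rf_mult_inf)

lemma rfm_mat1 [simp]:
  "rfm_regular (mat 1) a" "rfm_eval (mat 1) a = mat 1"
  "rfm_regular_inf (mat 1)" "rfm_eval_inf (mat 1) = mat 1"
  by (auto simp: rfm_regular_def rfm_eval_def rfm_regular_inf_def rfm_eval_inf_def mat_def vec_eq_iff)

lemma rfm_finite_poles: "finite {a. \<not> rfm_regular g a}"
proof -
  have "{a. \<not> rfm_regular g a} = (\<Union>i\<in>UNIV. \<Union>j\<in>UNIV. {a. \<not> rf_regular (g $ i $ j) a})"
    by (auto simp: rfm_regular_def)
  then show ?thesis by (simp add: rf_finite_poles)
qed

lemma rfm_eqI: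
  assumes "finite S" "\<And>a. a \<notin> S \<Longrightarrow> rfm_regular g a \<Longrightarrow> rfm_regular h a \<Longrightarrow> rfm_eval g a = rfm_eval h a"
  shows "g = h"
  unfolding vec_eq_iff
proof (intro allI)
  fix i j
  show "g $ i $ j = h $ i $ j"
  proof (rule rf_eqI)
    show "finite (S \<union> {a. \<not> rfm_regular g a} \<union> {a. \<not> rfm_regular h a})"
      using assms(1) by (simp add: rfm_finite_poles)
  next
    fix a assume "a \<notin> S \<union> {a. \<not> rfm_regular g a} \<union> {a. \<not> rfm_regular h a}"
    then have "rfm_eval g a = rfm_eval h a" using assms(2) by auto
    then show "rf_eval (g $ i $ j) a = rf_eval (h $ i $ j) a"
      by (simp add: rfm_eval_def vec_eq_iff)
  qed
qed

lemma conj_transpose_mult: "conj_transpose (A ** B) = conj_transpose B ** conj_transpose A"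
  by (simp add: conj_transpose_def cnj_matrix_def transpose_def matrix_matrix_mult_def vec_eq_iff
      mult.commute)

lemma conj_transpose_mat1 [simp]: "conj_transpose (mat 1) = mat 1"
  by (simp add: conj_transpose_def cnj_matrix_def transpose_def mat_def vec_eq_iff)

lemma sandwich_identity:
  fixes A A' B B' :: "complex^'n^'n"
  assumes "A' ** A = mat 1" "B' ** B = mat 1"
  shows "(B' ** A') ** (A ** B) = mat 1"
  by (metis assms matrix_mul_assoc matrix_mul_rid)

text \<open>An identity of this shape that holds off a finite set extends to all regular points.\<close>
lemma identity_extends:
  fixes g :: "ratfun^'n^'n" and T :: "complex^'n^'n \<Rightarrow> complex^'n^'n" and \<sigma> :: "complex \<Rightarrow> complex"
  assumes fin: "finite S"
    and id: "\<And>l. l \<notin> S \<Longrightarrow> rfm_regular g (\<sigma> l) \<Longrightarrow> rfm_regular g l \<Longrightarrow>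
                T (rfm_eval g (\<sigma> l)) ** rfm_eval g l = mat 1"
    and T: "\<And>A i j. T A $ i $ j = t (A $ j $ i)" and t: "\<And>x. isCont t x" and \<sigma>: "\<And>x. isCont \<sigma> x"
    and inv: "\<And>x. \<sigma> (\<sigma> x) = x"
    and reg: "rfm_regular g (\<sigma> l)" "rfm_regular g l"
  shows "T (rfm_eval g (\<sigma> l)) ** rfm_eval g l = mat 1"
proof -
  define S' where "S' = S \<union> {a. \<not> rfm_regular g a} \<union> \<sigma> ` {a. \<not> rfm_regular g a}"
  have S': "finite S'" using fin by (simp add: S'_def rfm_finite_poles)
  have ev: "\<forall>\<^sub>F x in at l. x \<notin> S'"
    unfolding eventually_at_topological
  proof (intro exI conjI ballI impI)
    show "open (- (S' - {l}))"
      using S' by (intro open_Compl finite_imp_closed finite_Diff)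
  qed auto
  have "(T (rfm_eval g (\<sigma> l)) ** rfm_eval g l) $ i $ j = (mat 1 :: complex^'n^'n) $ i $ j" for i j
  proof -
    define F where "F = (\<lambda>x. (T (rfm_eval g (\<sigma> x)) ** rfm_eval g x) $ i $ j)"
    have F: "F = (\<lambda>x. \<Sum>k\<in>UNIV. t (rf_eval (g $ k $ i) (\<sigma> x)) * rf_eval (g $ k $ j) x)"
      by (simp add: F_def matrix_matrix_mult_def T rfm_eval_def)
    have c1: "isCont (rf_eval (g $ k $ j)) l" for k
      using reg by (intro rf_isCont) (simp add: rfm_regular_def)
    have c2: "isCont (rf_eval (g $ k $ i)) (\<sigma> l)" for k
      using reg by (intro rf_isCont) (simp add: rfm_regular_def)
    have c3: "isCont (\<lambda>x. t (rf_eval (g $ k $ i) (\<sigma> x))) l" for k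
      by (rule isCont_o2[OF isCont_o2[OF \<sigma> c2] t])
    have "isCont F l"
      unfolding F using c1 c3 by (intro continuous_sum continuous_mult) auto
    then have "(F \<longlongrightarrow> F l) (at l)" by (simp add: isCont_def)
    moreover have "\<forall>\<^sub>F x in at l. F x = (mat 1 :: complex^'n^'n) $ i $ j"
      using ev
    proof (rule eventually_mono)
      fix x assume x: "x \<notin> S'"
      have "rfm_regular g (\<sigma> x)"
      proof (rule ccontr)
        assume "\<not> rfm_regular g (\<sigma> x)"
        then have "\<sigma> (\<sigma> x) \<in> S'" unfolding S'_def by blast
        then show False using x unfolding inv by contradiction
      qed
      then show "F x = (mat 1 :: complex^'n^'n) $ i $ j"
        using x id[of x] unfolding S'_def F_def by simp
    qed
    ultimately have "((\<lambda>x. (mat 1 :: complex^'n^'n) $ i $ j) \<longlongrightarrow> F l) (at l)"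
      by (rule Lim_transform_eventually)
    then have "F l = (mat 1 :: complex^'n^'n) $ i $ j"
      by (simp add: tendsto_const_iff)
    then show ?thesis by (simp add: F_def)
  qed
  then show ?thesis by (simp add: vec_eq_iff)
qed

lemma conj_identity_extends:
  fixes g :: "ratfun^'n^'n"
  assumes "finite S"
    and "\<And>l. l \<notin> S \<Longrightarrow> rfm_regular g (cnj l) \<Longrightarrow> rfm_regular g l \<Longrightarrow>
                conj_transpose (rfm_eval g (cnj l)) ** rfm_eval g l = mat 1"
    and "rfm_regular g (cnj l)" "rfm_regular g l"
  shows "conj_transpose (rfm_eval g (cnj l)) ** rfm_eval g l = mat 1"
proof (rule identity_extends[where T = conj_transpose and t = cnj and \<sigma> = cnj])
  show "conj_transpose A $ i $ j = cnj (A $ j $ i)" for A :: "complex^'n^'n" and i j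
    by (simp add: conj_transpose_def cnj_matrix_def transpose_def)
qed (fact assms | simp add: isCont_cnj)+

lemma neg_identity_extends:
  fixes g :: "ratfun^'n^'n"
  assumes "finite S"
    and "\<And>l. l \<notin> S \<Longrightarrow> rfm_regular g (- l) \<Longrightarrow> rfm_regular g l \<Longrightarrow>
                transpose (rfm_eval g (- l)) ** rfm_eval g l = mat 1"
    and "rfm_regular g (- l)" "rfm_regular g l"
  shows "transpose (rfm_eval g (- l)) ** rfm_eval g l = mat 1"
proof (rule identity_extends[where T = transpose and t = "\<lambda>x. x" and \<sigma> = uminus])
  show "transpose A $ i $ j = A $ j $ i" for A :: "complex^'n^'n" and i j
    by (simp add: transpose_def)
qed (fact assms | simp)+

lemma rational_loops_mult:
  assumes g: "g \<in> rational_loops" and h: "h \<in> rational_loops"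
  shows "g ** h \<in> rational_loops"
proof -
  let ?S = "{a. \<not> rfm_regular g a} \<union> {a. \<not> rfm_regular h a}"
  have fin: "finite (?S \<union> s ` ?S)" for s :: "complex \<Rightarrow> complex"
    by (simp add: rfm_finite_poles)
  have 1: "conj_transpose (rfm_eval (g ** h) (cnj l)) ** rfm_eval (g ** h) l = mat 1"
    if "rfm_regular (g ** h) (cnj l)" "rfm_regular (g ** h) l" for l
  proof (rule conj_identity_extends[where S = "?S \<union> cnj ` ?S"])
    fix l assume "l \<notin> ?S \<union> cnj ` ?S"
    moreover from this have "cnj l \<notin> ?S"
      by (metis UnCI complex_cnj_cnj imageI)
    ultimately show "conj_transpose (rfm_eval (g ** h) (cnj l)) ** rfm_eval (g ** h) l = mat 1"
      using g h by (simp add: rfm_mult conj_transpose_mult rational_loops_def sandwich_identity)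
  qed (fact fin that)+
  have 2: "transpose (rfm_eval (g ** h) (- l)) ** rfm_eval (g ** h) l = mat 1"
    if "rfm_regular (g ** h) (- l)" "rfm_regular (g ** h) l" for l
  proof (rule neg_identity_extends[where S = "?S \<union> uminus ` ?S"])
    fix l assume "l \<notin> ?S \<union> uminus ` ?S"
    moreover from this have "- l \<notin> ?S"
      by (metis UnCI minus_minus imageI)
    ultimately show "transpose (rfm_eval (g ** h) (- l)) ** rfm_eval (g ** h) l = mat 1"
      using g h by (simp add: rfm_mult matrix_transpose_mul rational_loops_def sandwich_identity)
  qed (fact fin that)+
  show ?thesis
    using g h 1 2 by (simp add: rational_loops_def rfm_mult_inf det_mul)
qed

definition rf_neg :: "ratfun \<Rightarrow> ratfun" where
  "rf_neg r = Fract (pcompose (rf_num r) [:0, -1:]) (pcompose (rf_den r) [:0, -1:])"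

lemma rf_neg:
  assumes "rf_regular r (- a)"
  shows "rf_regular (rf_neg r) a \<and> rf_eval (rf_neg r) a = rf_eval r (- a)"
  using assms rf_Fract[of "pcompose (rf_den r) [:0, -1:]" a "pcompose (rf_num r) [:0, -1:]"]
  by (simp add: rf_neg_def rf_regular_def rf_eval_def poly_pcompose)

lemma coeff_pcompose_neg: "coeff (pcompose p [:0, -1::complex:]) n = (-1) ^ n * coeff p n"
  by (induction p arbitrary: n)
     (auto simp: pcompose_pCons coeff_pCons split: nat.splits)

lemma rf_neg_inf:
  assumes "rf_regular_inf r"
  shows "rf_regular_inf (rf_neg r) \<and> rf_eval_inf (rf_neg r) = rf_eval_inf r"
proof -
  let ?p = "pcompose (rf_num r) [:0, -1:]" and ?q = "pcompose (rf_den r) [:0, -1:]"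
  have deg: "degree ?p = degree (rf_num r)" "degree ?q = degree (rf_den r)"
    by (simp_all add: degree_pcompose)
  have "lead_coeff ?q \<noteq> 0"
    by (simp add: coeff_pcompose_neg deg)
  then have q: "?q \<noteq> 0" by fastforce
  have le: "degree ?p \<le> degree ?q"
    using assms by (simp add: rf_regular_inf_def deg)
  show ?thesis
    using rf_inf_Fract[OF q le]
    by (simp add: rf_neg_def deg coeff_pcompose_neg) (simp add: rf_eval_inf_def)
qed

lemma rational_loops_inverse:
  assumes g: "(g :: ratfun^'n^'n) \<in> rational_loops"
  shows "\<exists>h\<in>rational_loops. h ** g = mat 1"
proof -
  define h where "h = transpose (map_matrix rf_neg g)"
  have h: "rfm_regular h a \<and> rfm_eval h a = transpose (rfm_eval g (- a))"
    if "rfm_regular g (- a)" for a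
    using that by (auto simp: h_def rfm_regular_def rfm_eval_def transpose_def vec_eq_iff rf_neg)
  have hinf: "rfm_regular_inf h \<and> rfm_eval_inf h = transpose (rfm_eval_inf g)"
    using g by (auto simp: h_def rfm_regular_inf_def rfm_eval_inf_def transpose_def vec_eq_iff
        rf_neg_inf rational_loops_def)
  let ?S = "{a. \<not> rfm_regular g a} \<union> uminus ` {a. \<not> rfm_regular g a}"
  have fin: "finite ?S" by (simp add: rfm_finite_poles)
  have fin': "finite (?S \<union> cnj ` ?S)" by (simp add: rfm_finite_poles)
  have regm: "rfm_regular g (- a)" if "a \<notin> ?S" for a
    using that by (metis (mono_tags, lifting) UnCI imageI mem_Collect_eq minus_minus)
  have hg: "h ** g = mat 1"
  proof (rule rfm_eqI[OF fin])
    fix a assume a: "a \<notin> ?S"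
    then show "rfm_eval (h ** g) a = rfm_eval (mat 1) a"
      using g h[OF regm[OF a]] regm[OF a] rfm_mult[of h a g] by (auto simp: rational_loops_def)
  qed
  have det: "det h \<noteq> 0"
    using hg by (metis det_I det_mul mult_zero_left zero_neq_one)
  have 1: "conj_transpose (rfm_eval h (cnj l)) ** rfm_eval h l = mat 1"
    if "rfm_regular h (cnj l)" "rfm_regular h l" for l
  proof (rule conj_identity_extends[where S = "?S \<union> cnj ` ?S"])
    fix l assume l: "l \<notin> ?S \<union> cnj ` ?S"
    then have "cnj l \<notin> ?S" by (metis UnCI complex_cnj_cnj imageI)
    then have r: "rfm_regular g (- l)" "rfm_regular g (cnj (- l))"
      using regm[of l] regm[of "cnj l"] l by auto
    define X where "X = rfm_eval g (- l)"
    define Y where "Y = rfm_eval g (cnj (- l))"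
    have "conj_transpose Y ** X = mat 1"
      using g r unfolding rational_loops_def X_def Y_def by blast
    then have "X ** conj_transpose Y = mat 1" by (simp add: matrix_left_right_inverse)
    then have "transpose (X ** conj_transpose Y) = mat 1" by (simp add: transpose_mat)
    then have "cnj_matrix Y ** transpose X = mat 1"
      by (simp add: matrix_transpose_mul conj_transpose_def)
    moreover have "rfm_eval h l = transpose X" "rfm_eval h (cnj l) = transpose Y"
      using h[of l] h[of "cnj l"] r by (auto simp: X_def Y_def)
    moreover have "conj_transpose (transpose Y) = cnj_matrix Y"
      by (simp add: conj_transpose_def cnj_matrix_def transpose_def vec_eq_iff)
    ultimately show "conj_transpose (rfm_eval h (cnj l)) ** rfm_eval h l = mat 1" by simp
  qed (fact fin' that)+
  have 2: "transpose (rfm_eval h (- l)) ** rfm_eval h l = mat 1"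
    if "rfm_regular h (- l)" "rfm_regular h l" for l
  proof (rule neg_identity_extends[where S = ?S])
    fix l assume l: "l \<notin> ?S"
    define X where "X = rfm_eval g l"
    define Y where "Y = rfm_eval g (- l)"
    have r: "rfm_regular g l" "rfm_regular g (- l)"
      using regm[of l] l by auto
    then have "transpose Y ** X = mat 1"
      using g unfolding rational_loops_def X_def Y_def by blast
    then have "X ** transpose Y = mat 1" by (simp add: matrix_left_right_inverse)
    then show "transpose (rfm_eval h (- l)) ** rfm_eval h l = mat 1"
      using h[of l] h[of "- l"] r by (simp add: X_def Y_def)
  qed (fact fin that)+
  have "h \<in> rational_loops"
    using g 1 2 det hinf by (simp add: rational_loops_def transpose_mat)
  then show ?thesis using hg by blast
qed

lemma group_Lambda_group: "group (Lambda_group :: (ratfun^'n^'n) monoid)"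
proof (rule groupI)
  show "\<one>\<^bsub>Lambda_group\<^esub> \<in> carrier (Lambda_group :: (ratfun^'n^'n) monoid)"
    by (simp add: Lambda_group_def rational_loops_def transpose_mat)
qed (auto simp: Lambda_group_def rational_loops_mult rational_loops_inverse matrix_mul_assoc)

lemma g_factor_eval:
  assumes "l \<noteq> z"
  shows "rfm_regular (g_factor z P) l"
    and "rfm_eval (g_factor z P) l = (\<chi> i j. P $ i $ j + (l - cnj z) / (l - z) * (mat 1 - P) $ i $ j)"
proof -
  have *: "rf_regular (Fract [:- cnj z, 1:] [:- z, 1:]) l \<and>
        rf_eval (Fract [:- cnj z, 1:] [:- z, 1:]) l = (l - cnj z) / (l - z)"
    using rf_Fract[of "[:- z, 1:]" l "[:- cnj z, 1:]"] assms by simp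
  show "rfm_regular (g_factor z P) l"
    using * by (simp add: rfm_regular_def g_factor_def rf_add rf_mult)
  show "rfm_eval (g_factor z P) l = (\<chi> i j. P $ i $ j + (l - cnj z) / (l - z) * (mat 1 - P) $ i $ j)"
    using * by (simp add: rfm_eval_def g_factor_def rf_add rf_mult vec_eq_iff)
qed

end

theory Submission
  imports Defs
begin

text \<open>
  Let \<open>g\<close> be a loop. The two symmetries say that the inverse of \<open>g\<close> at \<open>l\<close> is both the adjoint of
  \<open>g\<close> at \<open>cnj l\<close> and the transpose of \<open>g\<close> at \<open>- l\<close>; hence \<open>g (- cnj l)\<close> is the complex conjugate
  of \<open>g l\<close> (\<open>loop_reality\<close>). Only two half planes have to be watched: on the real axis \<open>g\<close> is unitary,
  hence bounded, hence regular, and the reflection \<open>l \<mapsto> - l\<close> exchanges the lower half plane with the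
  upper one. So if \<open>g\<close> is regular and invertible at every point of the lower half plane, then it is
  regular everywhere, also at infinity, and is therefore constant, equal to the identity (\<open>loop_eq_1\<close>).

  An arbitrary loop is brought to this situation by multiplying it with simple elements and their
  inverses. Poles in the lower half plane are moved to the upper one by the scalar elements, those
  with projection zero; the number of steps is controlled by a common denominator of the entries
  (\<open>generate_of_denominator\<close>). Then zeros of the determinant in the lower half plane are removed
  (\<open>generate_of_determinant\<close>). If \<open>g a\<close> is singular, where \<open>Im a < 0\<close>, take for \<open>mat 1 - P\<close> the
  projection onto the kernel of \<open>g a\<close>, and divide \<open>g\<close> on the right by an element with pole \<open>cnj a\<close>.
  The factor \<open>g_factor (cnj a) P\<close> has an inverse with a simple pole at \<open>a\<close>, with residue a multiple of
  \<open>mat 1 - P\<close>, so that \<open>g\<close> cancels this pole. If \<open>a\<close> is imaginary, then \<open>g a\<close> is a real matrix, so is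
  \<open>P\<close>, and this factor is itself a simple element. Otherwise one divides by \<open>f_factor (cnj a) P\<close>.

  The point in the second case is that no further computation of residues is needed, thanks to the
  exchange relation (\<open>f_factor_exchange\<close>)
  \<open>f_factor z P = g_factor (- cnj z) \<rho> ** g_factor z P = g_factor z (cnj \<rho>) ** g_factor (- cnj z) (cnj P)\<close>.
  The inverse of the first product shows that the quotient of \<open>g\<close> is regular at \<open>cnj z\<close>; that of
  the second product, together with \<open>g (- z) = cnj (g (cnj z))\<close>, shows that it is regular at \<open>- z\<close>.
  The exchange relation also gives the symmetry of \<open>f_factor z P\<close> under \<open>l \<mapsto> - l\<close>. It amounts to
  identities between projections, which are proved by algebra from the description of the image
  of \<open>\<rho>\<close> (\<open>rho_relations\<close>, \<open>exchange_sum_rule\<close>).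
\<close>

section \<open>Algebra of complex matrices\<close>

no_notation fps_nth (infixl "$" 75)

definition cscale :: "complex \<Rightarrow> complex^'n^'n \<Rightarrow> complex^'n^'n"  (infixr "*\<^sub>C" 75) where
  "c *\<^sub>C A = map_matrix (\<lambda>x. c * x) A"

lemma cscale_component [simp]: "(c *\<^sub>C A) $ i $ j = c * A $ i $ j"
  by (simp add: cscale_def)

lemma matrix_mult_expand:
  fixes A B C :: "complex^'n^'n"
  shows "A ** (B + C) = A ** B + A ** C" "(A + B) ** C = A ** C + B ** C"
    "A ** (B - C) = A ** B - A ** C" "(A - B) ** C = A ** C - B ** C"
    "(- A) ** B = - (A ** B)" "A ** (- B) = - (A ** B)"
    "A ** (c *\<^sub>C B) = c *\<^sub>C (A ** B)" "(c *\<^sub>C A) ** B = c *\<^sub>C (A ** B)"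
    "(A ** B) ** C = A ** (B ** C)" "0 ** A = 0" "A ** 0 = 0"
proof -
  show "(A ** B) ** C = A ** (B ** C)" by (simp add: matrix_mul_assoc)
qed (simp_all add: matrix_matrix_mult_def vec_eq_iff sum.distrib sum_subtractf sum_negf
      sum_distrib_left algebra_simps)

lemma cscale_expand:
  "c *\<^sub>C (A + B) = c *\<^sub>C A + c *\<^sub>C B" "c *\<^sub>C (A - B) = c *\<^sub>C A - c *\<^sub>C B"
  "c *\<^sub>C (- A) = - (c *\<^sub>C A)" "c *\<^sub>C d *\<^sub>C A = (c * d) *\<^sub>C A" "c *\<^sub>C 0 = 0" "0 *\<^sub>C A = 0" "1 *\<^sub>C A = A"
  by (simp_all add: vec_eq_iff algebra_simps)

lemma conj_transpose_component [simp]: "conj_transpose A $ i $ j = cnj (A $ j $ i)"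
  by (simp add: conj_transpose_def cnj_matrix_def transpose_def)

lemma cnj_matrix_component [simp]: "cnj_matrix A $ i $ j = cnj (A $ i $ j)"
  by (simp add: cnj_matrix_def)

lemma conj_transpose_expand:
  "conj_transpose (A + B) = conj_transpose A + conj_transpose B"
  "conj_transpose (A - B) = conj_transpose A - conj_transpose B"
  "conj_transpose (c *\<^sub>C A) = cnj c *\<^sub>C conj_transpose A"
  "conj_transpose (conj_transpose A) = A" "conj_transpose 0 = 0"
  by (simp_all add: vec_eq_iff)

lemma cnj_matrix_expand:
  "cnj_matrix (A + B) = cnj_matrix A + cnj_matrix B"
  "cnj_matrix (A - B) = cnj_matrix A - cnj_matrix B"
  "cnj_matrix (c *\<^sub>C A) = cnj c *\<^sub>C cnj_matrix A"
  "cnj_matrix (A ** B) = cnj_matrix A ** cnj_matrix B"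
  "cnj_matrix (cnj_matrix A) = A" "cnj_matrix (mat 1) = mat 1"
  by (simp_all add: vec_eq_iff matrix_matrix_mult_def mat_def)

lemma transpose_expand:
  "transpose (A + B) = transpose A + transpose B"
  "transpose (A - B) = transpose A - transpose B"
  "transpose (c *\<^sub>C A) = c *\<^sub>C transpose A"
  by (simp_all add: vec_eq_iff transpose_def)

text \<open>
  The diagonal entries of the product are the squared norms of the columns of \<open>A\<close>.
\<close>
lemma conj_transpose_mult_self_eq_0:
  assumes "conj_transpose A ** A = 0"
  shows "A = (0 :: complex^'n^'n)"
proof -
  have "(\<Sum>k\<in>UNIV. (cmod (A $ k $ j))\<^sup>2) = 0" for j
  proof -
    have "of_real (\<Sum>k\<in>UNIV. (cmod (A $ k $ j))\<^sup>2) = (conj_transpose A ** A) $ j $ j"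
      by (simp add: matrix_matrix_mult_def complex_norm_square mult.commute del: of_real_power)
    then show ?thesis using assms by (simp only: zero_index of_real_eq_0_iff)
  qed
  then show ?thesis by (simp add: sum_nonneg_eq_0_iff vec_eq_iff)
qed

text \<open>
  Here \<open>p, q, r, s\<close> stand for the complements of \<open>P\<close>, \<open>cnj P\<close>, \<open>\<rho>\<close>, \<open>cnj \<rho>\<close>. The conclusion \<open>r + p = s + q\<close>
  compares the leading terms at infinity of the two factorizations of \<open>f_factor z P\<close>. Put
  \<open>D = p - q\<close> and let \<open>E = s - r - D\<close> be the defect. The hypothesis \<open>R1\<close>, its complex conjugate, and
  the adjoints of both are linear in \<open>r\<close> and \<open>s\<close>; combined, they give \<open>2 E = t (E D - D E)\<close> and
  \<open>t (E D + D E) = 0\<close>, so \<open>E = t E D\<close>. Since \<open>t\<close> is imaginary and \<open>E\<close>, \<open>D\<close> are Hermitian, \<open>E E = t E D E\<close>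
  equates a Hermitian matrix with a skew-Hermitian one; so both vanish, and then \<open>E = 0\<close>.
\<close>
lemma exchange_sum_rule:
  fixes p q r s :: "complex^'n^'n"
  assumes herm: "conj_transpose p = p" "conj_transpose q = q" "conj_transpose r = r" "conj_transpose s = s"
    and idem: "p ** p = p" "q ** q = q"
    and conj: "q = cnj_matrix p" "s = cnj_matrix r"
    and t: "cnj t = - t"
    and R1: "r - t *\<^sub>C (r ** p) = q + t *\<^sub>C q - t *\<^sub>C (r ** q) - t *\<^sub>C (p ** q)"
  shows "s = r + p - q"
proof (cases "t = 0")
  case True
  then have "r = q" using R1 by (simp add: cscale_expand)
  then show ?thesis using conj by (simp add: cnj_matrix_expand)
next
  case False
  note expand = matrix_mult_expand cscale_expand
  have cnj_pq: "cnj_matrix p = q" "cnj_matrix q = p" "cnj_matrix r = s"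
    using conj by (simp_all add: cnj_matrix_expand)
  have adj: "conj_transpose (A ** B) = conj_transpose B ** conj_transpose A" for A B :: "complex^'n^'n"
    by (rule conj_transpose_mult)
  have R2: "s + t *\<^sub>C (s ** q) = p - t *\<^sub>C p + t *\<^sub>C (s ** p) + t *\<^sub>C (q ** p)"
    using arg_cong[OF R1, of cnj_matrix] t
    by (simp add: cnj_matrix_expand cnj_pq) (simp add: vec_eq_iff algebra_simps)
  have R1': "r + t *\<^sub>C (p ** r) = q - t *\<^sub>C q + t *\<^sub>C (q ** r) + t *\<^sub>C (q ** p)"
    using arg_cong[OF R1, of conj_transpose] t
    by (simp add: conj_transpose_expand adj herm) (simp add: vec_eq_iff algebra_simps)
  have R2': "s - t *\<^sub>C (q ** s) = p + t *\<^sub>C p - t *\<^sub>C (p ** s) - t *\<^sub>C (p ** q)"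
    using arg_cong[OF R2, of conj_transpose] t
    by (simp add: conj_transpose_expand adj herm) (simp add: vec_eq_iff algebra_simps)
  define E where "E = s - r - p + q"
  define D where "D = p - q"
  note entries = R1[unfolded vec_eq_iff, rule_format, simplified] R2[unfolded vec_eq_iff, rule_format, simplified]
    R1'[unfolded vec_eq_iff, rule_format, simplified] R2'[unfolded vec_eq_iff, rule_format, simplified]
  have 1: "2 *\<^sub>C E = t *\<^sub>C (E ** D - D ** E)"
    unfolding vec_eq_iff
  proof (intro allI)
    fix i j
    show "(2 *\<^sub>C E) $ i $ j = (t *\<^sub>C (E ** D - D ** E)) $ i $ j"
      using entries[of i j] unfolding E_def D_def expand idem by simp algebra
  qed
  have 2: "t *\<^sub>C (E ** D + D ** E) = 0"
    unfolding vec_eq_iff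
  proof (intro allI)
    fix i j
    show "(t *\<^sub>C (E ** D + D ** E)) $ i $ j = (0 :: complex^'n^'n) $ i $ j"
      using entries[of i j] unfolding E_def D_def expand idem by simp algebra
  qed
  have E: "E = t *\<^sub>C (E ** D)"
    unfolding vec_eq_iff
  proof (intro allI)
    fix i j
    show "E $ i $ j = (t *\<^sub>C (E ** D)) $ i $ j"
      using 1[unfolded vec_eq_iff, rule_format, of i j] 2[unfolded vec_eq_iff, rule_format, of i j]
      by simp algebra
  qed
  have EH: "conj_transpose E = E" and DH: "conj_transpose D = D"
    by (simp_all add: E_def D_def conj_transpose_expand herm)
  have 3: "E ** E = t *\<^sub>C (E ** (D ** E))"
    by (subst (1) E) (simp add: expand)
  have "E ** E = - (t *\<^sub>C (E ** (D ** E)))"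
    using arg_cong[OF 3, of conj_transpose] t
    by (simp add: conj_transpose_expand adj EH DH expand vec_eq_iff)
  then have "E ** E = 0" using 3 by (simp add: vec_eq_iff)
  then have "E = 0" using conj_transpose_mult_self_eq_0[of E] EH by simp
  then show ?thesis by (simp add: E_def algebra_simps)
qed

section \<open>Hermitian projections\<close>

lemma hermitian_projectionD:
  assumes "hermitian_projection P"
  shows "P ** P = P" "conj_transpose P = P" "transpose P = cnj_matrix P"
proof -
  show "P ** P = P" "conj_transpose P = P" using assms by (auto simp: hermitian_projection_def)
  then show "transpose P = cnj_matrix P"
    by (metis conj_transpose_def cnj_matrix_expand(5) transpose_transpose)
qed

lemma hermitian_projection_compl:
  "hermitian_projection P \<Longrightarrow> hermitian_projection (mat 1 - P)"
  by (simp add: hermitian_projection_def matrix_mult_expand conj_transpose_expand)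

lemma hermitian_projection_cnj:
  assumes "hermitian_projection P"
  shows "hermitian_projection (cnj_matrix P)"
proof -
  have "cnj_matrix P ** cnj_matrix P = cnj_matrix P"
    by (metis assms cnj_matrix_expand(4) hermitian_projectionD(1))
  moreover have "conj_transpose (cnj_matrix P) = cnj_matrix P"
    using hermitian_projectionD(3)[OF assms] by (simp add: conj_transpose_def cnj_matrix_expand)
  ultimately show ?thesis by (simp add: hermitian_projection_def)
qed

lemma hermitian_projection_0: "hermitian_projection (0 :: complex^'n^'n)"
  by (simp add: hermitian_projection_def matrix_mult_expand conj_transpose_expand)

lemma projection_image_iff:
  fixes P :: "complex^'n^'n"
  assumes "P ** P = P"
  shows "v \<in> matrix_image P \<longleftrightarrow> P *v v = v"
proof
  assume "v \<in> matrix_image P"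
  then obtain u where "v = P *v u" by (auto simp: matrix_image_def)
  then show "P *v v = v" by (simp add: matrix_vector_mul_assoc assms)
next
  assume "P *v v = v"
  then show "v \<in> matrix_image P" unfolding matrix_image_def by (metis rangeI)
qed

text \<open>
  With equal images \<open>P\<close> and \<open>Q\<close> absorb each other: \<open>P Q = Q\<close> and \<open>Q P = P\<close>. The adjoint of the first
  identity is \<open>Q P = Q\<close>.
\<close>
lemma hermitian_projection_unique:
  fixes P Q :: "complex^'n^'n"
  assumes P: "hermitian_projection P" and Q: "hermitian_projection Q"
    and "matrix_image P = matrix_image Q"
  shows "P = Q"
proof -
  have PQ: "A ** B = B" if "A ** A = A" "matrix_image B \<subseteq> matrix_image A" for A B :: "complex^'n^'n"
  proof -
    have "(A ** B) *v v = B *v v" for v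
      using that projection_image_iff[of A "B *v v"]
      by (auto simp: matrix_image_def simp flip: matrix_vector_mul_assoc)
    then show ?thesis by (simp add: matrix_eq)
  qed
  have 1: "P ** Q = Q" by (rule PQ) (simp_all add: assms hermitian_projectionD)
  have 2: "Q ** P = P" by (rule PQ) (simp_all add: assms hermitian_projectionD)
  have "Q = conj_transpose (P ** Q)" using 1 Q by (simp add: hermitian_projectionD)
  also have "\<dots> = Q ** P" using P Q by (simp add: conj_transpose_mult hermitian_projectionD)
  finally show ?thesis using 2 by simp
qed

lemma inner_imaginary_unit:
  fixes x y :: "complex^'n"
  shows "(\<i> *s x) \<bullet> y = - (x \<bullet> (\<i> *s y))"
  by (simp add: inner_vec_def inner_complex_def sum_negf algebra_simps flip: sum_negf)

text \<open>
  Orthogonal decomposition for the real inner product, the real part of the Hermitian one, gives a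
  real linear \<open>f\<close>. Since \<open>W\<close> is stable under multiplication by \<open>\<i>\<close>, uniqueness of the decomposition
  makes \<open>f\<close> complex linear, and symmetry for the real inner product tested on \<open>axis i 1\<close> and
  \<open>\<i> *s axis i 1\<close> yields the real and the imaginary part of Hermitian symmetry.
\<close>
lemma hermitian_projection_exists:
  fixes W :: "(complex^'n) set"
  assumes W: "vec.subspace W"
  shows "\<exists>P. hermitian_projection P \<and> matrix_image P = W"
proof -
  have scaleR: "c *\<^sub>R x = of_real c *s x" for c and x :: "complex^'n"
    by (simp only: vec_eq_iff vector_scaleR_component vector_smult_component) (simp add: scaleR_conv_of_real)
  have real_sub: "subspace W"
    using W by (auto simp: subspace_def vec.subspace_def scaleR)
  then have spanW: "span W = W" by simp
  have "\<exists>y. y \<in> W \<and> (\<forall>w\<in>W. (x - y) \<bullet> w = 0)" for x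
    by (rule orthogonal_subspace_decomp_exists[of W x]) (auto simp: spanW orthogonal_def)
  then obtain f where fW: "f x \<in> W" and orth: "\<And>w. w \<in> W \<Longrightarrow> (x - f x) \<bullet> w = 0" for x
    by metis
  have f_eq: "f x = y" if "y \<in> W" "\<And>w. w \<in> W \<Longrightarrow> (x - y) \<bullet> w = 0" for x y
  proof -
    have d: "f x - y \<in> W" using fW that(1) by (rule subspace_diff[OF real_sub])
    have "(f x - y) \<bullet> (f x - y) = (x - y) \<bullet> (f x - y) - (x - f x) \<bullet> (f x - y)"
      by (simp add: algebra_simps)
    then show ?thesis using that(2)[OF d] orth[OF d] by simp
  qed
  have f_add: "f (x + y) = f x + f y" for x y
  proof (rule f_eq)
    show "f x + f y \<in> W" using fW by (rule vec.subspace_add[OF W fW])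
    fix w assume "w \<in> W"
    then show "(x + y - (f x + f y)) \<bullet> w = 0"
      using orth[of w x] orth[of w y] by (simp add: inner_diff_left inner_add_left)
  qed
  have f_real: "f (a *\<^sub>R x) = a *\<^sub>R f x" for a x
  proof (rule f_eq)
    show "a *\<^sub>R f x \<in> W" using fW by (rule subspace_scale[OF real_sub])
    fix w assume "w \<in> W"
    then show "(a *\<^sub>R x - a *\<^sub>R f x) \<bullet> w = 0"
      using orth[of w x] by (simp add: inner_diff_left)
  qed
  have f_ii: "f (\<i> *s x) = \<i> *s f x" for x
  proof (rule f_eq)
    show "\<i> *s f x \<in> W" using fW by (rule vec.subspace_scale[OF W])
    fix w assume "w \<in> W"
    then have "\<i> *s w \<in> W" by (rule vec.subspace_scale[OF W])
    then show "(\<i> *s x - \<i> *s f x) \<bullet> w = 0"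
      unfolding vec.scale_right_diff_distrib[symmetric] inner_imaginary_unit
      using orth[of "\<i> *s w" x] by simp
  qed
  have f_scale: "f (c *s x) = c *s f x" for c x
  proof -
    have "c *s y = Re c *\<^sub>R y + Im c *\<^sub>R (\<i> *s y)" for y :: "complex^'n"
      unfolding scaleR vector_smult_assoc vec.scale_left_distrib[symmetric]
      using complex_eq[of c] by (simp add: mult.commute)
    then show ?thesis by (simp add: f_add f_real f_ii)
  qed
  have "Vector_Spaces.linear (*s) (*s) f"
    by unfold_locales (simp_all add: f_add f_scale)
  then have mv: "matrix f *v x = f x" for x by (rule matrix_works)
  have f_fix: "f w = w" if "w \<in> W" for w
    by (rule f_eq) (use that in auto)
  have img: "matrix_image (matrix f) = W"
  proof
    show "matrix_image (matrix f) \<subseteq> W" using fW by (auto simp: matrix_image_def mv)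
    show "W \<subseteq> matrix_image (matrix f)"
      unfolding matrix_image_def mv using f_fix by (metis rangeI subsetI)
  qed
  have idem: "matrix f ** matrix f = matrix f"
    by (simp add: matrix_eq mv f_fix fW flip: matrix_vector_mul_assoc)
  have sym: "f x \<bullet> y = x \<bullet> f y" for x y
  proof -
    have "f x \<bullet> y = f x \<bullet> f y"
      using orth[OF fW[of x], of y] by (simp add: inner_diff_right inner_commute[of _ "f x"])
    also have "\<dots> = x \<bullet> f y"
      using orth[OF fW[of y], of x] by (simp add: inner_diff_left)
    finally show ?thesis .
  qed
  have axis_right: "x \<bullet> (c *s axis i 1) = x $ i \<bullet> c" for x :: "complex^'n" and c i
  proof -
    have "c *s axis i 1 = axis i c" by (simp add: vec_eq_iff axis_def)
    then show ?thesis by (simp add: inner_axis)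
  qed
  have "cnj (matrix f $ j $ i) = matrix f $ i $ j" for i j
  proof -
    have e: "matrix f $ k $ l = f (axis l 1) $ k" for k l by (simp add: matrix_def)
    have re: "f (axis j 1) \<bullet> (1 *s axis i 1) = f (axis i 1) \<bullet> (1 *s axis j 1)"
      using sym[of "axis j 1" "axis i 1"] by (simp add: inner_commute)
    have "f (axis j 1) \<bullet> (\<i> *s axis i 1) = axis j 1 \<bullet> (\<i> *s f (axis i 1))"
      by (simp add: sym f_scale)
    also have "\<dots> = - (f (axis i 1) \<bullet> (\<i> *s axis j 1))"
      by (metis inner_imaginary_unit inner_commute)
    finally show ?thesis
      using re unfolding axis_right e by (simp add: complex_eq_iff inner_complex_def)
  qed
  then have "hermitian_projection (matrix f)"
    using idem by (simp add: hermitian_projection_def vec_eq_iff)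
  then show ?thesis using img by blast
qed

lemma projection_onto:
  fixes W :: "(complex^'n) set"
  assumes "vec.subspace W"
  shows "hermitian_projection (projection_onto W)" "matrix_image (projection_onto W) = W"
proof -
  have "\<exists>!P. hermitian_projection P \<and> matrix_image P = W"
    using hermitian_projection_exists[OF assms] hermitian_projection_unique by blast
  then have "hermitian_projection (projection_onto W) \<and> matrix_image (projection_onto W) = W"
    unfolding projection_onto_def by (rule theI')
  then show "hermitian_projection (projection_onto W)" "matrix_image (projection_onto W) = W"
    by auto
qed

lemma cnj_matrix_0: "cnj_matrix 0 = 0"
  by (simp add: vec_eq_iff)

text \<open>
  The projection \<open>P\<close> whose complement is the projection \<open>E\<close> onto the kernel of \<open>A\<close>. It is real if \<open>A\<close> is:
  then \<open>A\<close> annihilates \<open>cnj E\<close> too, so \<open>E\<close> absorbs it, and adjoint and conjugate of \<open>E (cnj E) = cnj E\<close>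
  identify \<open>(cnj E) E\<close> with \<open>cnj E\<close> and with \<open>E\<close>.
\<close>
lemma kernel_projection:
  fixes A :: "complex^'n^'n"
  assumes "det A = 0"
  obtains P where "hermitian_projection P" "A ** (mat 1 - P) = 0" "det P = 0"
    "cnj_matrix A = A \<Longrightarrow> cnj_matrix P = P"
proof -
  define K where "K = {v. A *v v = 0}"
  define E where "E = projection_onto K"
  have "vec.subspace K"
    by (auto simp: K_def vec.subspace_def matrix_vector_right_distrib vec.scale)
  then have E: "hermitian_projection E" and img: "matrix_image E = K"
    unfolding E_def by (rule projection_onto)+
  have E_fix: "E *v v = v \<longleftrightarrow> A *v v = 0" for v
    using projection_image_iff[of E v] E img by (auto simp: hermitian_projectionD K_def)
  have absorb: "E ** B = B" if "A ** B = 0" for B :: "complex^'n^'n"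
  proof -
    have "E *v (B *v v) = B *v v" for v
    proof -
      have "A *v (B *v v) = 0" using that by (simp add: matrix_vector_mul_assoc)
      then show ?thesis by (simp only: E_fix)
    qed
    then show ?thesis by (simp add: matrix_eq flip: matrix_vector_mul_assoc)
  qed
  have "A *v (E *v v) = 0" for v
    unfolding E_fix[symmetric] using E by (simp add: matrix_vector_mul_assoc hermitian_projectionD)
  then have AE: "A ** E = 0" by (simp add: matrix_eq flip: matrix_vector_mul_assoc)
  show ?thesis
  proof (rule that[of "mat 1 - E"])
    show "hermitian_projection (mat 1 - E)" by (rule hermitian_projection_compl[OF E])
    show "A ** (mat 1 - (mat 1 - E)) = 0" using AE by simp
    have "\<not> invertible A" using assms by (simp add: invertible_det_nz)
    then obtain v where v: "A *v v = 0" "v \<noteq> 0"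
      using matrix_left_invertible_ker[of A] invertible_left_inverse[of A] by auto
    then have "(mat 1 - E) *v v = 0" using E_fix[of v] by (simp add: matrix_vector_mult_diff_rdistrib)
    then show "det (mat 1 - E) = 0"
      using v(2) by (metis invertible_det_nz invertible_left_inverse matrix_left_invertible_ker)
    assume real: "cnj_matrix A = A"
    have "A ** cnj_matrix E = cnj_matrix (A ** E)" by (simp add: cnj_matrix_expand real)
    then have 1: "E ** cnj_matrix E = cnj_matrix E" by (intro absorb) (simp add: AE cnj_matrix_0)
    have "cnj_matrix E = conj_transpose (E ** cnj_matrix E)"
      unfolding 1 by (rule hermitian_projectionD(2)[OF hermitian_projection_cnj[OF E], symmetric])
    also have "\<dots> = cnj_matrix E ** E"
      by (simp add: conj_transpose_mult hermitian_projectionD hermitian_projection_cnj E)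
    also have "\<dots> = cnj_matrix (E ** cnj_matrix E)" by (simp add: cnj_matrix_expand)
    also have "\<dots> = E" unfolding 1 by (simp add: cnj_matrix_expand)
    finally show "cnj_matrix (mat 1 - E) = mat 1 - E" by (simp add: cnj_matrix_expand)
  qed
qed

lemma subspace_matrix_image: "vec.subspace (matrix_image A)"
  unfolding matrix_image_def
  by (rule vec.subspace_image[OF vec.subspace_UNIV])

section \<open>The simple factors and the exchange relation\<close>

text \<open>
  The value of \<open>g_factor z P\<close> at \<open>l\<close>, split into its value at infinity and its principal part at \<open>z\<close>.
\<close>
definition gval :: "complex \<Rightarrow> complex^'n^'n \<Rightarrow> complex \<Rightarrow> complex^'n^'n" where
  "gval z P l = mat 1 + ((z - cnj z) / (l - z)) *\<^sub>C (mat 1 - P)"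

lemma g_factor_regular: "l \<noteq> z \<Longrightarrow> rfm_regular (g_factor z P) l"
  by (rule g_factor_eval)

lemma g_factor_gval: "l \<noteq> z \<Longrightarrow> rfm_eval (g_factor z P) l = gval z P l"
proof -
  assume l: "l \<noteq> z"
  have "(l - cnj z) / (l - z) = 1 + (z - cnj z) / (l - z)"
    using l by (simp add: add_divide_eq_iff)
  then show ?thesis using l
    by (simp add: g_factor_eval gval_def vec_eq_iff ring_distribs)
qed

lemma gval_inverse:
  assumes "P ** P = P" "l \<noteq> z" "l \<noteq> cnj z"
  shows "gval (cnj z) P l ** gval z P l = mat 1"
proof -
  define p where "p = mat 1 - P"
  have pp: "p ** p = p" using assms(1) by (simp add: p_def matrix_mult_expand)
  define x where "x = (cnj z - z) / (l - cnj z)"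
  define y where "y = (z - cnj z) / (l - z)"
  have xy: "x + y + x * y = 0"
  proof -
    have "1 + x = (l - z) / (l - cnj z)" "1 + y = (l - cnj z) / (l - z)"
      using assms(2,3) by (simp_all add: x_def y_def add_divide_eq_iff)
    then have "(1 + x) * (1 + y) = 1" using assms(2,3) by simp
    then show ?thesis by algebra
  qed
  have "gval (cnj z) P l ** gval z P l = (mat 1 + x *\<^sub>C p) ** (mat 1 + y *\<^sub>C p)"
    by (simp add: gval_def p_def x_def y_def)
  also have "\<dots> = mat 1 + (x + y + x * y) *\<^sub>C p"
    unfolding matrix_mult_expand cscale_expand pp by (simp add: vec_eq_iff algebra_simps)
  finally show ?thesis by (simp add: xy cscale_expand)
qed

lemma conj_transpose_gval:
  "conj_transpose P = P \<Longrightarrow> conj_transpose (gval z P (cnj l)) = gval (cnj z) P l"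
  by (simp add: gval_def conj_transpose_expand)

lemma transpose_gval:
  "transpose (gval z P (- l)) = gval (- z) (transpose P) l"
proof -
  have "(z - cnj z) / (- l - z) = (- z - cnj (- z)) / (l - - z)"
  proof -
    have "- l - z = - (l - - z)" "- z - cnj (- z) = - (z - cnj z)" by simp_all
    then show ?thesis by (simp only: minus_divide_left[symmetric] minus_divide_right[symmetric])
  qed
  then show ?thesis by (simp add: gval_def transpose_expand transpose_mat)
qed

text \<open>
  The quotient is \<open>\<i> * Im z / Re z\<close>. It occurs as the coefficient in
  \<open>gval z P (- cnj z) = mat 1 - t *\<^sub>C (mat 1 - P)\<close>, called \<open>M\<close> below.
\<close>
lemma cnj_imaginary_quotient: "cnj ((z - cnj z) / (z + cnj z)) = - ((z - cnj z) / (z + cnj z))"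
proof -
  have "cnj ((z - cnj z) / (z + cnj z)) = (cnj z - z) / (z + cnj z)" by (simp add: add.commute)
  also have "cnj z - z = - (z - cnj z)" by simp
  finally show ?thesis by (simp only: minus_divide_left)
qed

text \<open>
  The image of \<open>\<rho>\<close> is \<open>M (Im (cnj P))\<close>. That it contains \<open>M (Im (cnj P))\<close> means
  \<open>r M (mat 1 - q) = 0\<close>. For the converse inclusion, \<open>N = mat 1 - t + t p\<close> is a scalar multiple of the
  inverse of \<open>M\<close>, so \<open>q N\<close> vanishes on the image of \<open>\<rho>\<close>, and the adjoint of
  \<open>q N \<rho> = 0\<close> is a second relation, linear in \<open>r\<close>. Their difference is the conclusion.
\<close>
lemma rho_relations:
  fixes P :: "complex^'n^'n"
  assumes P: "hermitian_projection P" and z: "z + cnj z \<noteq> 0"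
  defines "t \<equiv> (z - cnj z) / (z + cnj z)"
  defines "p \<equiv> mat 1 - P" and "q \<equiv> mat 1 - cnj_matrix P" and "r \<equiv> mat 1 - f_rho z P"
  shows "hermitian_projection (f_rho z P)"
    and "r - t *\<^sub>C (r ** p) = q + t *\<^sub>C q - t *\<^sub>C (r ** q) - t *\<^sub>C (p ** q)"
proof -
  define R where "R = f_rho z P"
  define Q where "Q = cnj_matrix P"
  define M where "M = mat 1 - t *\<^sub>C p"
  have ne: "- cnj z \<noteq> z" using z eq_neg_iff_add_eq_0[of z "cnj z"] by metis
  have "(z - cnj z) / (- cnj z - z) = - t"
  proof -
    have "- cnj z - z = - (z + cnj z)" by simp
    then show ?thesis by (simp only: t_def minus_divide_right)
  qed
  then have M: "rfm_eval (g_factor z P) (- cnj z) = M"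
    using ne by (simp add: g_factor_gval gval_def M_def p_def) (simp add: vec_eq_iff)
  have W: "(\<lambda>v. rfm_eval (g_factor z P) (- cnj z) *v v) ` matrix_image (cnj_matrix P) = matrix_image (M ** Q)"
    unfolding M by (auto simp: matrix_image_def Q_def image_iff matrix_vector_mul_assoc[symmetric])
  have R: "hermitian_projection R" and imR: "matrix_image R = matrix_image (M ** Q)"
    unfolding R_def f_rho_def W using projection_onto[OF subspace_matrix_image[of "M ** Q"]] by auto
  show "hermitian_projection (f_rho z P)" using R by (simp add: R_def)
  have QQ: "Q ** Q = Q" "conj_transpose Q = Q"
    using hermitian_projection_cnj[OF P] by (simp_all add: Q_def hermitian_projectionD)
  have pp: "p ** p = p" "conj_transpose p = p"
    using hermitian_projection_compl[OF P] by (simp_all add: p_def hermitian_projectionD)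
  have RR: "R ** R = R" "conj_transpose R = R" using R by (simp_all add: hermitian_projectionD)
  have "R *v ((M ** Q) *v v) = (M ** Q) *v v" for v
    using projection_image_iff[OF RR(1)] imR by (auto simp: matrix_image_def)
  then have 1: "R ** (M ** Q) = M ** Q"
    by (metis matrix_eq matrix_vector_mul_assoc)
  have q: "q = mat 1 - Q" by (simp add: q_def Q_def)
  have qQ: "q ** Q = 0" using QQ by (simp add: q matrix_mult_expand)
  have t: "cnj t = - t" unfolding t_def by (rule cnj_imaginary_quotient)
  define N where "N = mat 1 - t *\<^sub>C mat 1 + t *\<^sub>C p"
  have "N ** M = (1 - t) *\<^sub>C mat 1"
    by (simp add: N_def M_def matrix_mult_expand cscale_expand pp) (simp add: vec_eq_iff algebra_simps)
  then have NM: "q ** (N ** (M ** Q)) = 0"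
    by (metis (no_types) cscale_expand(5) matrix_mul_assoc matrix_mul_lid matrix_mult_expand(7,8) qQ)
  have "(q ** (N ** R)) *v v = 0" for v
  proof -
    have "R *v v \<in> matrix_image (M ** Q)"
      using imR by (auto simp: matrix_image_def)
    then obtain u where "R *v v = (M ** Q) *v u" by (auto simp: matrix_image_def)
    then have "(q ** (N ** R)) *v v = (q ** (N ** (M ** Q))) *v u"
      by (simp flip: matrix_vector_mul_assoc)
    then show ?thesis by (simp add: NM)
  qed
  then have "q ** (N ** R) = 0" by (simp add: matrix_eq)
  then have "conj_transpose (q ** (N ** R)) = 0" by (simp add: conj_transpose_expand)
  then have 2: "(R ** ((1 + t) *\<^sub>C mat 1 - t *\<^sub>C p)) ** q = 0"
    using t by (simp add: conj_transpose_mult N_def conj_transpose_expand RR pp q QQ matrix_mult_expand cscale_expand)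
        (simp add: vec_eq_iff algebra_simps)
  have Rr: "R = mat 1 - r" "Q = mat 1 - q" by (simp_all add: r_def R_def q)
  show "r - t *\<^sub>C (r ** p) = q + t *\<^sub>C q - t *\<^sub>C (r ** q) - t *\<^sub>C (p ** q)"
    unfolding vec_eq_iff
  proof (intro allI)
    fix i j
    show "(r - t *\<^sub>C (r ** p)) $ i $ j = (q + t *\<^sub>C q - t *\<^sub>C (r ** q) - t *\<^sub>C (p ** q)) $ i $ j"
      using 1[unfolded M_def Rr matrix_mult_expand cscale_expand vec_eq_iff, rule_format, of i j, simplified]
        2[unfolded Rr matrix_mult_expand cscale_expand vec_eq_iff, rule_format, of i j, simplified]
      by simp algebra
  qed
qed

text \<open>
  Both sides are \<open>mat 1\<close> plus a linear combination of the principal parts \<open>x\<close> at \<open>z\<close> and \<open>y\<close> at \<open>- cnj z\<close>,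
  because \<open>x y = t (x - y)\<close>. Comparing the coefficients leaves the identities \<open>F1\<close> and \<open>F2\<close>, which become
  the known relation for \<open>r\<close> when \<open>s\<close> is eliminated by \<open>exchange_sum_rule\<close>.
\<close>
lemma gval_exchange:
  fixes P :: "complex^'n^'n"
  assumes P: "hermitian_projection P" and z: "z + cnj z \<noteq> 0"
    and l: "l \<noteq> z" "l \<noteq> - cnj z"
  shows "gval (- cnj z) (f_rho z P) l ** gval z P l
       = gval z (cnj_matrix (f_rho z P)) l ** gval (- cnj z) (cnj_matrix P) l"
proof -
  define t where "t = (z - cnj z) / (z + cnj z)"
  define p q r s where "p = mat 1 - P" and "q = mat 1 - cnj_matrix P"
    and "r = mat 1 - f_rho z P" and "s = mat 1 - cnj_matrix (f_rho z P)"
  note defs = p_def q_def r_def s_def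
  have rho: "hermitian_projection (f_rho z P)"
    and rel: "r - t *\<^sub>C (r ** p) = q + t *\<^sub>C q - t *\<^sub>C (r ** q) - t *\<^sub>C (p ** q)"
    using rho_relations[OF P z] by (simp_all add: defs t_def)
  have proj: "hermitian_projection p" "hermitian_projection q" "hermitian_projection r"
      "hermitian_projection s"
    unfolding defs by (intro hermitian_projection_compl hermitian_projection_cnj P rho)+
  have cnj: "q = cnj_matrix p" "s = cnj_matrix r" "p = cnj_matrix q"
    by (simp_all add: defs cnj_matrix_expand)
  have t: "cnj t = - t" unfolding t_def by (rule cnj_imaginary_quotient)
  have s: "s = r + p - q"
    by (rule exchange_sum_rule[OF _ _ _ _ _ _ cnj(1,2) t rel])
       (simp_all add: proj hermitian_projectionD)
  have pp: "p ** p = p" "q ** q = q" by (simp_all add: proj hermitian_projectionD)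
  have F2: "r - t *\<^sub>C (r ** p) = q - t *\<^sub>C (s ** q)"
    using rel unfolding s by (simp add: matrix_mult_expand pp cscale_expand)
  have F1: "s + t *\<^sub>C (s ** q) = p + t *\<^sub>C (r ** p)"
    using F2 unfolding s by (simp add: algebra_simps)
  define x where "x = (z - cnj z) / (l - z)"
  define y where "y = (z - cnj z) / (l - - cnj z)"
  have xy: "x * y = t * x - t * y"
  proof -
    have "l - z \<noteq> 0" "l + cnj z \<noteq> 0" using l by (auto simp: eq_neg_iff_add_eq_0)
    then show ?thesis
      using z unfolding x_def y_def t_def by (simp add: divide_simps) (simp add: algebra_simps)
  qed
  have gz: "gval z A l = mat 1 + x *\<^sub>C (mat 1 - A)" for A :: "complex^'n^'n"
    by (simp add: gval_def x_def)
  have gz': "gval (- cnj z) A l = mat 1 + y *\<^sub>C (mat 1 - A)" for A :: "complex^'n^'n"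
    by (simp add: gval_def y_def)
  have "gval (- cnj z) (f_rho z P) l ** gval z P l = (mat 1 + y *\<^sub>C r) ** (mat 1 + x *\<^sub>C p)"
    by (simp add: gz gz' defs)
  also have "\<dots> = mat 1 + y *\<^sub>C (r - t *\<^sub>C (r ** p)) + x *\<^sub>C (p + t *\<^sub>C (r ** p))"
    unfolding matrix_mult_expand cscale_expand xy by (simp add: vec_eq_iff algebra_simps)
  also have "\<dots> = mat 1 + y *\<^sub>C (q - t *\<^sub>C (s ** q)) + x *\<^sub>C (s + t *\<^sub>C (s ** q))"
    by (simp add: F1 F2)
  also have "\<dots> = mat 1 + x *\<^sub>C s + y *\<^sub>C q + (x * y) *\<^sub>C (s ** q)"
    unfolding xy by (simp add: vec_eq_iff algebra_simps)
  also have "\<dots> = (mat 1 + x *\<^sub>C s) ** (mat 1 + y *\<^sub>C q)"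
    unfolding matrix_mult_expand cscale_expand by (simp add: vec_eq_iff algebra_simps)
  also have "\<dots> = gval z (cnj_matrix (f_rho z P)) l ** gval (- cnj z) (cnj_matrix P) l"
    by (simp add: gz gz' defs)
  finally show ?thesis .
qed

lemma g_factor_inverse:
  fixes P :: "complex^'n^'n"
  assumes "P ** P = P"
  shows "g_factor (cnj z) P ** g_factor z P = mat 1"
proof (rule rfm_eqI[where S = "{z, cnj z}"])
  fix a assume "a \<notin> {z, cnj z}"
  then show "rfm_eval (g_factor (cnj z) P ** g_factor z P) a = rfm_eval (mat 1) a"
    using assms by (simp add: rfm_mult g_factor_regular g_factor_gval gval_inverse)
qed simp

lemma f_factor_exchange:
  fixes P :: "complex^'n^'n"
  assumes "hermitian_projection P" and "z + cnj z \<noteq> 0"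
  shows "f_factor z P = g_factor z (cnj_matrix (f_rho z P)) ** g_factor (- cnj z) (cnj_matrix P)"
  unfolding f_factor_def
proof (rule rfm_eqI[where S = "{z, - cnj z}"])
  fix a assume "a \<notin> {z, - cnj z}"
  then show "rfm_eval (g_factor (- cnj z) (f_rho z P) ** g_factor z P) a =
      rfm_eval (g_factor z (cnj_matrix (f_rho z P)) ** g_factor (- cnj z) (cnj_matrix P)) a"
    using assms by (simp add: rfm_mult g_factor_regular g_factor_gval gval_exchange)
qed simp

lemma g_factor_at_infinity:
  fixes P :: "complex^'n^'n"
  shows "rfm_regular_inf (g_factor z P)" "rfm_eval_inf (g_factor z P) = mat 1"
proof -
  have b: "rf_regular_inf (Fract [:- cnj z, 1:] [:- z, 1:])"
      "rf_eval_inf (Fract [:- cnj z, 1:] [:- z, 1:]) = 1"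
    using rf_inf_Fract[of "[:- z, 1:]" "[:- cnj z, 1:]"] by simp_all
  have "rf_regular_inf (g_factor z P $ i $ j) \<and> rf_eval_inf (g_factor z P $ i $ j) = (mat 1 :: complex^'n^'n) $ i $ j" for i j
    using rf_add_inf[of "rf_const (P $ i $ j)" "Fract [:- cnj z, 1:] [:- z, 1:] * rf_const ((mat 1 - P) $ i $ j)"]
      rf_mult_inf[of "Fract [:- cnj z, 1:] [:- z, 1:]" "rf_const ((mat 1 - P) $ i $ j)"]
    by (simp add: g_factor_def b)
  then show "rfm_regular_inf (g_factor z P)" "rfm_eval_inf (g_factor z P) = mat 1"
    by (simp_all add: rfm_regular_inf_def rfm_eval_inf_def vec_eq_iff)
qed

lemma det_g_factor:
  fixes P :: "complex^'n^'n"
  assumes "hermitian_projection P"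
  shows "det (g_factor z P) \<noteq> 0"
proof -
  have "det (g_factor (cnj z) P) * det (g_factor z P) = 1"
    using g_factor_inverse[of P z] assms by (metis det_I det_mul hermitian_projectionD(1))
  then show ?thesis by auto
qed

lemma f_rho_projection:
  fixes P :: "complex^'n^'n"
  assumes "hermitian_projection P" "z + cnj z \<noteq> 0"
  shows "hermitian_projection (f_rho z P)"
  using rho_relations(1)[OF assms] .

text \<open>
  The parameter of the inverse as a variable, to match the various forms such as \<open>- z\<close> or
  \<open>cnj (- cnj z)\<close> in which it arises.
\<close>
lemma gval_inverse_conj:
  assumes "hermitian_projection P" "l \<noteq> z" "l \<noteq> cnj z" "z' = cnj z"
  shows "gval z' P l ** gval z P l = mat 1"
  using assms gval_inverse hermitian_projectionD(1) by metis

lemma g_factor_in_rational_loops: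
  fixes P :: "complex^'n^'n"
  assumes P: "hermitian_projection P" "cnj_matrix P = P" and z: "cnj z = - z"
  shows "g_factor z P \<in> rational_loops"
proof -
  have "conj_transpose (rfm_eval (g_factor z P) (cnj l)) ** rfm_eval (g_factor z P) l = mat 1"
    if "rfm_regular (g_factor z P) (cnj l)" "rfm_regular (g_factor z P) l" for l
  proof (rule conj_identity_extends[where S = "{z, cnj z}"])
    fix l assume "l \<notin> {z, cnj z}"
    then have "l \<noteq> z" "l \<noteq> cnj z" "cnj l \<noteq> z" by auto
    then show "conj_transpose (rfm_eval (g_factor z P) (cnj l)) ** rfm_eval (g_factor z P) l = mat 1"
      using P by (simp add: g_factor_gval conj_transpose_gval hermitian_projectionD gval_inverse)
  qed (use that in auto)
  moreover have "transpose (rfm_eval (g_factor z P) (- l)) ** rfm_eval (g_factor z P) l = mat 1"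
    if "rfm_regular (g_factor z P) (- l)" "rfm_regular (g_factor z P) l" for l
  proof (rule neg_identity_extends[where S = "{z, - z}"])
    fix l assume "l \<notin> {z, - z}"
    then have "l \<noteq> z" "- l \<noteq> z" "l \<noteq> cnj z" using z by auto
    then show "transpose (rfm_eval (g_factor z P) (- l)) ** rfm_eval (g_factor z P) l = mat 1"
      using P z by (simp add: g_factor_gval transpose_gval hermitian_projectionD gval_inverse_conj)
  qed (use that in auto)
  ultimately show ?thesis
    using P by (simp add: rational_loops_def det_g_factor g_factor_at_infinity)
qed

text \<open>
  Each symmetry reduces to telescoping of a product of four factors. Under \<open>l \<mapsto> cnj l\<close> this works with one
  and the same factorization; under \<open>l \<mapsto> - l\<close> the transposed factors of one factorization are inverse
  to those of the other one.
\<close>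
lemma f_factor_in_rational_loops:
  fixes P :: "complex^'n^'n"
  assumes P: "hermitian_projection P" and z: "z + cnj z \<noteq> 0"
  shows "f_factor z P \<in> rational_loops"
proof -
  let ?f = "f_factor z P"
  define R where "R = f_rho z P"
  have R: "hermitian_projection R" using f_rho_projection[OF assms] by (simp add: R_def)
  have f: "rfm_eval ?f l = gval (- cnj z) R l ** gval z P l" if "l \<noteq> z" "l \<noteq> - cnj z" for l
    using that by (simp add: f_factor_def rfm_mult g_factor_regular g_factor_gval R_def)
  have f': "rfm_eval ?f l = gval z (cnj_matrix R) l ** gval (- cnj z) (cnj_matrix P) l"
    if "l \<noteq> z" "l \<noteq> - cnj z" for l
    unfolding f[OF that] using gval_exchange[OF assms that] by (simp add: R_def)
  have "conj_transpose (rfm_eval ?f (cnj l)) ** rfm_eval ?f l = mat 1"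
    if "rfm_regular ?f (cnj l)" "rfm_regular ?f l" for l
  proof (rule conj_identity_extends[where S = "{z, cnj z, - z, - cnj z}"])
    fix l assume "l \<notin> {z, cnj z, - z, - cnj z}"
    then have l: "l \<noteq> z" "l \<noteq> cnj z" "l \<noteq> - z" "l \<noteq> - cnj z" "cnj l \<noteq> z" "cnj l \<noteq> - cnj z"
      by (auto simp: complex_cnj_minus[symmetric] simp del: complex_cnj_minus)
    show "conj_transpose (rfm_eval ?f (cnj l)) ** rfm_eval ?f l = mat 1"
      unfolding f[OF l(5,6)] f[OF l(1,4)] conj_transpose_mult
      by (rule sandwich_identity) (use P R l in \<open>simp_all add: conj_transpose_gval hermitian_projectionD gval_inverse_conj\<close>)
  qed (use that in auto)
  moreover have "transpose (rfm_eval ?f (- l)) ** rfm_eval ?f l = mat 1"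
    if "rfm_regular ?f (- l)" "rfm_regular ?f l" for l
  proof (rule neg_identity_extends[where S = "{z, cnj z, - z, - cnj z}"])
    fix l assume "l \<notin> {z, cnj z, - z, - cnj z}"
    then have l: "l \<noteq> z" "l \<noteq> cnj z" "l \<noteq> - z" "l \<noteq> - cnj z" "- l \<noteq> z" "- l \<noteq> - cnj z"
      by auto
    show "transpose (rfm_eval ?f (- l)) ** rfm_eval ?f l = mat 1"
      unfolding f[OF l(5,6)] f'[OF l(1,4)] matrix_transpose_mul
      by (rule sandwich_identity)
         (use P R l in \<open>simp_all add: transpose_gval hermitian_projectionD gval_inverse_conj hermitian_projection_cnj\<close>)
  qed (use that in auto)
  moreover have "det ?f \<noteq> 0" using P R by (simp add: f_factor_def R_def det_mul det_g_factor)
  moreover have "rfm_regular_inf ?f \<and> rfm_eval_inf ?f = mat 1"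
    by (simp add: f_factor_def rfm_mult_inf g_factor_at_infinity)
  ultimately show ?thesis by (simp add: rational_loops_def)
qed

section \<open>Regularity of rational functions\<close>

lemma rf_eval_to_fract [simp]: "rf_regular (to_fract p) a" "rf_eval (to_fract p) a = poly p a"
  using rf_Fract[of 1 a p] by (simp_all add: to_fract_def)

lemma rf_regular_mult: "rf_regular r a \<Longrightarrow> rf_regular s a \<Longrightarrow> rf_regular (r * s) a"
  by (simp add: rf_mult)

lemma rf_uminus:
  assumes "rf_regular r a"
  shows "rf_regular (- r) a \<and> rf_eval (- r) a = - rf_eval r a"
proof -
  have "rf_const (-1) = -1"
    by (simp add: rf_const_def to_fract_def one_pCons One_fract_def)
  then have "- r = rf_const (-1) * r" by simp
  then show ?thesis using rf_mult[of "rf_const (-1)" a r] assms by simp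
qed

lemma rf_prod:
  assumes "\<And>k. k \<in> A \<Longrightarrow> rf_regular (f k) a"
  shows "rf_regular (prod f A) a \<and> rf_eval (prod f A) a = (\<Prod>k\<in>A. rf_eval (f k) a)"
  using assms by (induction A rule: infinite_finite_induct) (auto simp: rf_mult)

lemma rf_det:
  fixes g :: "ratfun^'n^'n"
  assumes "rfm_regular g a"
  shows rf_regular_det: "rf_regular (det g) a" and rf_eval_det: "rf_eval (det g) a = det (rfm_eval g a)"
proof -
  have pr: "rf_regular (\<Prod>i\<in>UNIV. g $ i $ p i) a \<and>
      rf_eval (\<Prod>i\<in>UNIV. g $ i $ p i) a = (\<Prod>i\<in>UNIV. rfm_eval g a $ i $ p i)" for p
    using rf_prod[of UNIV "\<lambda>i. g $ i $ p i" a] assms by (simp add: rfm_regular_def rfm_eval_def)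
  have "rf_regular (of_int (sign p) * (\<Prod>i\<in>UNIV. g $ i $ p i)) a \<and>
      rf_eval (of_int (sign p) * (\<Prod>i\<in>UNIV. g $ i $ p i)) a =
      of_int (sign p) * (\<Prod>i\<in>UNIV. rfm_eval g a $ i $ p i)" for p :: "'n \<Rightarrow> 'n"
    using pr[of p] by (cases p rule: sign_cases) (simp_all add: rf_uminus)
  then show "rf_regular (det g) a" "rf_eval (det g) a = det (rfm_eval g a)"
    using rf_sum[of "{p. p permutes (UNIV :: 'n set)}" "\<lambda>p. of_int (sign p) * (\<Prod>i\<in>UNIV. g $ i $ p i)" a]
    by (simp_all add: det_def)
qed

lemma rf_inverse_regular:
  assumes "rf_regular r a" "rf_eval r a \<noteq> 0"
  shows "rf_regular (1 / r) a"
proof -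
  have "1 / r = 1 / Fract (rf_num r) (rf_den r)" by simp
  also have "\<dots> = Fract (rf_den r) (rf_num r)" by (simp only: One_fract_def divide_fract mult_1 mult_1_right)
  finally show ?thesis
    using assms rf_Fract[of "rf_num r" a "rf_den r"] by (simp add: rf_eval_def)
qed

lemma rf_divide_root_regular:
  assumes "rf_regular r b" and "rf_regular r a" and "rf_eval r a = 0"
  shows "rf_regular (r / to_fract [:- a, 1:]) b"
proof -
  have "poly (rf_num r) a = 0"
    using assms(2,3) by (simp add: rf_eval_def rf_regular_def)
  then obtain u where u: "rf_num r = [:- a, 1:] * u" using poly_eq_0_iff_dvd by blast
  have "r = Fract (rf_num r) (rf_den r)" by simp
  also have "\<dots> = to_fract [:- a, 1:] * Fract u (rf_den r)"
    by (simp add: u to_fract_def)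
  finally have "r / to_fract [:- a, 1:] = Fract u (rf_den r)"
    by (simp add: to_fract_eq_0_iff field_simps)
  then show ?thesis using rf_Fract[of "rf_den r" b u] assms(1) by (simp add: rf_regular_def)
qed

text \<open>
  In lowest terms, numerator and denominator have no common zero, so a rational function is unbounded
  along any filter tending to a pole.
\<close>
lemma rf_regular_if_bounded:
  assumes lim: "(h \<longlongrightarrow> w) F" "F \<noteq> bot"
    and ev: "\<forall>\<^sub>F x in F. rf_regular r (h x) \<and> cmod (rf_eval r (h x)) \<le> B"
  shows "rf_regular r w"
proof (rule ccontr)
  assume "\<not> rf_regular r w"
  then have d: "poly (rf_den r) w = 0" by (simp add: rf_regular_def)
  have "coprime (rf_num r) (rf_den r)"
    unfolding rf_num_def rf_den_def by (rule coprime_quot_of_fract)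
  then have n: "poly (rf_num r) w \<noteq> 0" using d coprime_poly_0 by blast
  have "((\<lambda>x. cmod (poly (rf_num r) (h x))) \<longlongrightarrow> cmod (poly (rf_num r) w)) F"
       "((\<lambda>x. B * cmod (poly (rf_den r) (h x))) \<longlongrightarrow> B * cmod (poly (rf_den r) w)) F"
    by (intro tendsto_intros lim)+
  moreover have "\<forall>\<^sub>F x in F. cmod (poly (rf_num r) (h x)) \<le> B * cmod (poly (rf_den r) (h x))"
    using ev by (rule eventually_mono) (auto simp: rf_regular_def rf_eval_def norm_divide divide_simps)
  ultimately have "cmod (poly (rf_num r) w) \<le> B * cmod (poly (rf_den r) w)"
    using tendsto_le[OF lim(2)] by blast
  then show False using d n by simp
qed

text \<open>
  The denominator has no zero, hence is constant, and regularity at infinity bounds the degree of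
  the numerator.
\<close>
lemma rf_everywhere_regular_const:
  assumes "\<And>a. rf_regular r a" and "rf_regular_inf r"
  shows "r = rf_const (rf_eval_inf r)"
proof (rule rf_eqI[of "{}"])
  fix a
  have "degree (rf_den r) = 0"
  proof (rule ccontr)
    assume "degree (rf_den r) \<noteq> 0"
    then have "\<exists>z. poly (rf_den r) z = 0"
      by (intro fundamental_theorem_of_algebra) (simp add: constant_degree)
    then show False using assms(1) by (auto simp: rf_regular_def)
  qed
  moreover from this have "degree (rf_num r) = 0" using assms(2) by (simp add: rf_regular_inf_def)
  ultimately have "rf_eval r a = rf_eval_inf r"
    by (auto simp: rf_eval_def rf_eval_inf_def elim!: degree_eq_zeroE)
  then show "rf_eval r a = rf_eval (rf_const (rf_eval_inf r)) a" by simp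
qed simp

section \<open>Loops without zeros and poles in the lower half plane\<close>

lemma eventually_real_avoids_finite:
  fixes w :: complex
  assumes "w \<in> \<real>" "finite S"
  shows "\<forall>\<^sub>F x in at (Re w). of_real x \<notin> S"
proof -
  have "finite (of_real -` S :: real set)"
    using assms(2) by (intro finite_vimageI) (auto intro: injI)
  then have "open (- (of_real -` S - {Re w}) :: real set)"
    by (intro open_Compl finite_imp_closed finite_Diff)
  then show ?thesis
    unfolding eventually_at_topological by (intro exI[of _ "- (of_real -` S - {Re w})"]) auto
qed

text \<open>
  At a real point the first symmetry makes the value unitary, so that the entries are bounded by 1.
\<close>
lemma loop_regular_real:
  fixes g :: "ratfun^'n^'n"
  assumes g: "g \<in> rational_loops" and w: "w \<in> \<real>"
  shows "rfm_regular g w"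
  unfolding rfm_regular_def
proof (intro allI)
  fix i j
  have "cmod (rfm_eval g (of_real x) $ i $ j) \<le> 1" if "rfm_regular g (of_real x)" for x
  proof -
    let ?A = "rfm_eval g (of_real x)"
    have "conj_transpose ?A ** ?A = mat 1"
      using g that unfolding rational_loops_def by (metis (mono_tags, lifting) complex_cnj_complex_of_real mem_Collect_eq)
    then have "(conj_transpose ?A ** ?A) $ j $ j = 1" by (simp add: mat_def)
    then have "complex_of_real (\<Sum>k\<in>UNIV. (cmod (?A $ k $ j))\<^sup>2) = 1"
      by (simp add: matrix_matrix_mult_def conj_transpose_def cnj_matrix_def transpose_def
          complex_norm_square mult.commute del: of_real_power)
    then have "(\<Sum>k\<in>UNIV. (cmod (?A $ k $ j))\<^sup>2) = 1" by (simp only: of_real_eq_1_iff)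
    moreover have "(cmod (?A $ i $ j))\<^sup>2 \<le> (\<Sum>k\<in>UNIV. (cmod (?A $ k $ j))\<^sup>2)"
      by (rule member_le_sum) auto
    ultimately show ?thesis by (simp add: power_le_one_iff abs_le_square_iff[of _ 1, simplified])
  qed
  then have "rf_regular (g $ i $ j) (of_real x) \<and> cmod (rf_eval (g $ i $ j) (of_real x)) \<le> 1"
    if "rfm_regular g (of_real x)" for x
    using that by (simp add: rfm_eval_def rfm_regular_def)
  then have "\<forall>\<^sub>F x in at (Re w). rf_regular (g $ i $ j) (of_real x) \<and> cmod (rf_eval (g $ i $ j) (of_real x)) \<le> 1"
    using eventually_real_avoids_finite[OF w rfm_finite_poles[of g]] by (auto elim: eventually_mono)
  moreover have "((\<lambda>x. of_real x) \<longlongrightarrow> w) (at (Re w))"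
    using tendsto_of_real[OF tendsto_ident_at[of "Re w" UNIV]] of_real_Re[OF w] by metis
  ultimately show "rf_regular (g $ i $ j) w"
    using rf_regular_if_bounded[of of_real w "at (Re w)" "g $ i $ j" 1] by simp
qed

text \<open>
  The rational matrix \<open>h\<close>, the transpose of \<open>g (- l)\<close>, is the inverse of \<open>g\<close>. So Cramer's rule expresses the entries
  of \<open>g\<close> by those of \<open>h\<close>, divided by a determinant that does not vanish at \<open>a\<close>.
\<close>
lemma loop_regular_reflected:
  fixes g :: "ratfun^'n^'n"
  assumes g: "g \<in> rational_loops" and reg: "rfm_regular g (- a)" and det: "det (rfm_eval g (- a)) \<noteq> 0"
  shows "rfm_regular g a"
proof -
  define h where "h = transpose (map_matrix rf_neg g)"
  have h: "rfm_regular h b \<and> rfm_eval h b = transpose (rfm_eval g (- b))"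
    if "rfm_regular g (- b)" for b
    using that by (auto simp: h_def rfm_regular_def rfm_eval_def transpose_def vec_eq_iff rf_neg)
  have hg: "h ** g = mat 1"
  proof (rule rfm_eqI)
    show "finite ({b. \<not> rfm_regular g b} \<union> uminus ` {b. \<not> rfm_regular g b})"
      by (simp add: rfm_finite_poles)
    fix b assume b: "b \<notin> {b. \<not> rfm_regular g b} \<union> uminus ` {b. \<not> rfm_regular g b}"
    then have r: "rfm_regular g b" "rfm_regular g (- b)"
      by (auto simp: image_iff)
    then show "rfm_eval (h ** g) b = rfm_eval (mat 1) b"
      using g h[OF r(2)] rfm_mult[of h b g] by (auto simp: rational_loops_def)
  qed
  have hr: "rfm_regular h a" and "rfm_eval h a = transpose (rfm_eval g (- a))"
    using h[OF reg] by auto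
  then have "rf_eval (det h) a \<noteq> 0" using det by (simp add: rf_eval_det)
  then have dinv: "rf_regular (1 / det h) a" and d0: "det h \<noteq> 0"
    using rf_inverse_regular[OF rf_regular_det[OF hr]] by auto
  have "rf_regular (g $ k $ j) a" for k j
  proof -
    define B :: "ratfun^'n^'n" where "B = (\<chi> i l. if l = k then column j (mat 1 :: ratfun^'n^'n) $ i else h $ i $ l)"
    have "h *v column j g = column j (mat 1)"
      unfolding hg[symmetric] by (simp add: vec_eq_iff column_def matrix_matrix_mult_def matrix_vector_mult_def)
    then have c: "column j g = (\<chi> k. det (\<chi> i l. if l = k then column j (mat 1) $ i else h $ i $ l) / det h)"
      unfolding cramer[OF d0] .
    have "column j g $ k = det B / det h"
      by (subst c) (simp add: B_def)
    then have "g $ k $ j = det B * (1 / det h)" by (simp add: column_def)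
    moreover have "rfm_regular B a"
      using hr by (auto simp: rfm_regular_def B_def column_def mat_def)
    ultimately show ?thesis using rf_mult[OF rf_regular_det dinv] by metis
  qed
  then show ?thesis by (simp add: rfm_regular_def)
qed

lemma loop_eq_1:
  fixes g :: "ratfun^'n^'n"
  assumes g: "g \<in> rational_loops"
    and below: "\<And>a. Im a < 0 \<Longrightarrow> rfm_regular g a \<and> det (rfm_eval g a) \<noteq> 0"
  shows "g = mat 1"
proof -
  have "rfm_regular g a" for a
  proof -
    consider "Im a < 0" | "Im a = 0" | "Im a > 0" by linarith
    then show ?thesis
    proof cases
      case 1
      then show ?thesis using below by simp
    next
      case 2
      then show ?thesis using loop_regular_real[OF g] by (simp add: complex_is_Real_iff)
    next
      case 3
      then have "Im (- a) < 0" by simp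
      then show ?thesis using loop_regular_reflected[OF g] below by blast
    qed
  qed
  then have "g $ i $ j = rf_const ((mat 1 :: complex^'n^'n) $ i $ j)" for i j
    using g rf_everywhere_regular_const[of "g $ i $ j"]
    by (auto simp: rational_loops_def rfm_regular_def rfm_regular_inf_def rfm_eval_inf_def vec_eq_iff)
  then show ?thesis by (simp add: vec_eq_iff mat_def rf_const_01)
qed

section \<open>Cancelling poles and zeros by a simple factor\<close>

abbreviation lin :: "complex \<Rightarrow> ratfun" where
  "lin a \<equiv> to_fract [:- a, 1:]"

abbreviation rfm_regular_below :: "ratfun^'n^'n \<Rightarrow> bool" where
  "rfm_regular_below g \<equiv> \<forall>b. Im b < 0 \<longrightarrow> rfm_regular g b"

lemma blaschke_lin: "Fract [:- cnj z, 1:] [:- z, 1:] = lin (cnj z) * (1 / lin z)"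
  by (simp add: to_fract_def One_fract_def)

lemma rf_inverse_lin_regular: "b \<noteq> a \<Longrightarrow> rf_regular (1 / lin a) b"
  by (rule rf_inverse_regular) auto

lemma rfm_regular_matrix_mult: "rfm_regular g a \<Longrightarrow> rfm_regular h a \<Longrightarrow> rfm_regular (g ** h) a"
  by (simp add: rfm_mult)

text \<open>
  The pole of the factor at \<open>a\<close> is simple with residue a multiple of \<open>mat 1 - P\<close>.
\<close>
lemma regular_mult_g_factor:
  fixes g :: "ratfun^'n^'n"
  assumes g: "rfm_regular g a" and ker: "rfm_eval g a ** (mat 1 - P) = 0"
  shows "rfm_regular (g ** g_factor a P) a"
  unfolding rfm_regular_def
proof (intro allI)
  fix i j
  define u where "u = (\<Sum>k\<in>UNIV. g $ i $ k * rf_const (P $ k $ j))"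
  define v where "v = (\<Sum>k\<in>UNIV. g $ i $ k * rf_const ((mat 1 - P) $ k $ j))"
  have gr: "rf_regular (g $ i $ k) a" for k using g by (simp add: rfm_regular_def)
  have u: "rf_regular u a" unfolding u_def by (simp add: rf_sum rf_mult gr)
  have "rf_regular v a \<and> rf_eval v a = (rfm_eval g a ** (mat 1 - P)) $ i $ j"
    unfolding v_def by (simp add: rf_sum rf_mult gr matrix_matrix_mult_def rfm_eval_def)
  then have v: "rf_regular (v / lin a) a" using ker rf_divide_root_regular[of v a a] by simp
  have "(g ** g_factor a P) $ i $ j = u + lin (cnj a) * (v / lin a)"
    unfolding matrix_matrix_mult_def g_factor_def blaschke_lin u_def v_def
    by (simp add: distrib_left sum.distrib sum_distrib_left sum_divide_distrib mult_ac)
  then show "rf_regular ((g ** g_factor a P) $ i $ j) a"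
    using u v by (simp only: rf_add rf_regular_mult rf_eval_to_fract)
qed

text \<open>
  At \<open>cnj z\<close> the factor takes the singular value \<open>P\<close>.
\<close>
lemma det_g_factor_divisible:
  fixes P :: "complex^'n^'n"
  assumes "det P = 0" "cnj z \<noteq> z" "b \<noteq> z"
  shows "rf_regular (det (g_factor z P) / lin (cnj z)) b"
proof (rule rf_divide_root_regular)
  have "(z - cnj z) / (cnj z - z) = -1"
    using assms(2) by (simp add: divide_eq_eq)
  then have "gval z P (cnj z) = P" by (simp add: gval_def vec_eq_iff)
  then show "rf_eval (det (g_factor z P)) (cnj z) = 0"
    using assms by (simp add: rf_eval_det g_factor_regular g_factor_gval)
qed (use assms in \<open>simp_all add: rf_regular_det g_factor_regular\<close>)

text \<open>
  At a generic point the adjoint of \<open>g a\<close> and the transpose of \<open>g (- cnj a)\<close> are both inverse to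
  \<open>g (cnj a)\<close>. The identity is then extended by continuity: \<open>g\<close> may have a pole at \<open>cnj a\<close>.
\<close>
lemma loop_reality:
  fixes g :: "ratfun^'n^'n"
  assumes g: "g \<in> rational_loops" and reg: "rfm_regular g a" "rfm_regular g (- cnj a)"
  shows "rfm_eval g (- cnj a) = cnj_matrix (rfm_eval g a)"
proof -
  let ?N = "{b. \<not> rfm_regular g b}"
  define S where "S = ?N \<union> cnj ` ?N \<union> (\<lambda>b. - cnj b) ` ?N"
  have "finite S" by (simp add: S_def rfm_finite_poles)
  then have "open (- (S - {a}))"
    by (intro open_Compl finite_imp_closed finite_Diff)
  then have ev: "\<forall>\<^sub>F x in at a. x \<notin> S"
    unfolding eventually_at_topological by (intro exI[of _ "- (S - {a})"]) auto
  have gen: "rfm_eval g (- cnj x) = cnj_matrix (rfm_eval g x)" if "x \<notin> S" for x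
  proof -
    have r: "rfm_regular g x" "rfm_regular g (cnj x)" "rfm_regular g (- cnj x)"
    proof -
      show "rfm_regular g x" using that by (auto simp: S_def)
      show "rfm_regular g (cnj x)"
        using that unfolding S_def by (metis (mono_tags, lifting) UnCI complex_cnj_cnj imageI mem_Collect_eq)
      show "rfm_regular g (- cnj x)"
      proof (rule ccontr)
        assume "\<not> rfm_regular g (- cnj x)"
        then have "- cnj (- cnj x) \<in> S" unfolding S_def by blast
        then show False using that by simp
      qed
    qed
    have "rfm_regular g (cnj (cnj x)) \<and> rfm_regular g (cnj x)" "rfm_regular g (- cnj x) \<and> rfm_regular g (cnj x)"
      using r by simp_all
    then have "conj_transpose (rfm_eval g (cnj (cnj x))) ** rfm_eval g (cnj x) = mat 1"
        "transpose (rfm_eval g (- cnj x)) ** rfm_eval g (cnj x) = mat 1"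
      using g unfolding rational_loops_def by blast+
    then have "conj_transpose (rfm_eval g x) = transpose (rfm_eval g (- cnj x))"
      by (metis complex_cnj_cnj matrix_left_right_inverse matrix_mul_assoc matrix_mul_lid matrix_mul_rid)
    then show ?thesis by (metis conj_transpose_def transpose_transpose)
  qed
  have "rf_eval (g $ i $ j) (- cnj a) = cnj (rf_eval (g $ i $ j) a)" for i j
  proof -
    let ?r = "g $ i $ j"
    have "isCont (rf_eval ?r) a" "isCont (rf_eval ?r) (- cnj a)"
      using reg by (auto intro!: rf_isCont simp: rfm_regular_def)
    then have lim1: "((\<lambda>x. rf_eval ?r (- cnj x)) \<longlongrightarrow> rf_eval ?r (- cnj a)) (at a)"
        and lim2: "((\<lambda>x. cnj (rf_eval ?r x)) \<longlongrightarrow> cnj (rf_eval ?r a)) (at a)"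
      by (auto intro!: tendsto_intros isCont_tendsto_compose[of _ "rf_eval ?r"] simp: isCont_def)
    have eq: "\<forall>\<^sub>F x in at a. rf_eval ?r (- cnj x) = cnj (rf_eval ?r x)"
      using ev by (rule eventually_mono) (use gen in \<open>auto simp: rfm_eval_def vec_eq_iff\<close>)
    have "((\<lambda>x. cnj (rf_eval ?r x)) \<longlongrightarrow> rf_eval ?r (- cnj a)) (at a)"
      by (rule Lim_transform_eventually[OF lim1 eq])
    then show ?thesis by (rule tendsto_unique[OF at_neq_bot _ lim2])
  qed
  then show ?thesis by (simp add: rfm_eval_def vec_eq_iff)
qed

definition simple_loops :: "(ratfun^'n^'n) set" where
  "simple_loops = {g_factor (\<i> * of_real s) P | s P.
               s \<noteq> 0 \<and> hermitian_projection P \<and> cnj_matrix P = P} \<union>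
            {f_factor z P | z P.
               z \<notin> \<real> \<union> range (\<lambda>t::real. \<i> * of_real t) \<and> hermitian_projection P}"

lemma sum_cnj_nonzero: "Re z \<noteq> 0 \<Longrightarrow> z + cnj z \<noteq> 0"
  by (simp add: complex_eq_iff)

lemma not_imaginary: "z \<notin> range (\<lambda>t::real. \<i> * of_real t) \<longleftrightarrow> Re z \<noteq> 0"
  by (auto simp: image_iff complex_eq_iff)

lemma simple_loops_subset: "simple_loops \<subseteq> (rational_loops :: (ratfun^'n^'n) set)"
  unfolding simple_loops_def
proof (intro Un_least subsetI)
  fix g :: "ratfun^'n^'n"
  assume "g \<in> {g_factor (\<i> * of_real s) P | s P. s \<noteq> 0 \<and> hermitian_projection P \<and> cnj_matrix P = P}"
  then show "g \<in> rational_loops" by (auto intro: g_factor_in_rational_loops)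
next
  fix g :: "ratfun^'n^'n"
  assume "g \<in> {f_factor z P | z P. z \<notin> \<real> \<union> range (\<lambda>t::real. \<i> * of_real t) \<and> hermitian_projection P}"
  then show "g \<in> rational_loops"
    using not_imaginary sum_cnj_nonzero by (blast intro: f_factor_in_rational_loops)
qed

text \<open>
  For \<open>z\<close> in the upper half plane, a simple element whose rightmost factor is \<open>g_factor z P\<close>, and whose other
  factor \<open>m\<close> has its pole in the upper half plane too. The last property is what makes division by \<open>k\<close>
  possible: no pole arises in the lower half plane. In the non-imaginary case the inverse of \<open>k\<close> is factored
  as \<open>k1\<close> to exclude a pole at \<open>cnj z\<close>, and as \<open>k2\<close> to exclude a pole at \<open>- z\<close>.
\<close>
lemma simple_loop_with_factor:
  fixes P :: "complex^'n^'n"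
  assumes z: "Im z > 0" and P: "hermitian_projection P" and real: "Re z = 0 \<Longrightarrow> cnj_matrix P = P"
  obtains k kinv m where "k \<in> simple_loops" "k ** kinv = mat 1" "k = m ** g_factor z P" "rfm_regular_below m"
    "\<forall>g\<in>rational_loops. rfm_regular_below g \<longrightarrow> rfm_eval g (cnj z) ** (mat 1 - P) = 0
        \<longrightarrow> rfm_regular_below (g ** kinv)"
proof (cases "Re z = 0")
  case True
  then have "z = \<i> * of_real (Im z)" by (simp add: complex_eq_iff)
  then have "g_factor z P \<in> simple_loops"
    using z P real[OF True] unfolding simple_loops_def by (intro UnI1 CollectI exI[of _ "Im z"] exI[of _ P]) auto
  moreover have "g_factor z P ** g_factor (cnj z) P = mat 1"
    using g_factor_inverse[of P z] P by (simp add: hermitian_projectionD matrix_left_right_inverse)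
  moreover have "rfm_regular_below (g ** g_factor (cnj z) P)"
    if "g \<in> rational_loops" "rfm_regular_below g" "rfm_eval g (cnj z) ** (mat 1 - P) = 0" for g
  proof (intro allI impI)
    fix b assume "Im b < 0"
    then show "rfm_regular (g ** g_factor (cnj z) P) b"
      using that by (cases "b = cnj z") (auto intro: regular_mult_g_factor rfm_regular_matrix_mult g_factor_regular)
  qed
  ultimately show ?thesis
    using that[of "g_factor z P" "g_factor (cnj z) P" "mat 1"] by simp
next
  case False
  define R where "R = f_rho z P"
  have zz: "z + cnj z \<noteq> 0" using False by (rule sum_cnj_nonzero)
  have R: "hermitian_projection R" using f_rho_projection[OF P zz] by (simp add: R_def)
  let ?k = "f_factor z P"
  define k1 where "k1 = g_factor (cnj z) P ** g_factor (- z) R"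
  define k2 where "k2 = g_factor (- z) (cnj_matrix P) ** g_factor (cnj z) (cnj_matrix R)"
  have inv: "g_factor (cnj z) A ** g_factor z A = mat 1" "g_factor (- z) A ** g_factor (- cnj z) A = mat 1"
    if "hermitian_projection A" for A :: "complex^'n^'n"
    using g_factor_inverse[of A z] g_factor_inverse[of A "- cnj z"] that
    by (simp_all add: hermitian_projectionD)
  have sand: "(A ** B) ** (C ** D) = mat 1" if "A ** D = mat 1" "B ** C = mat 1" for A B C D :: "ratfun^'n^'n"
    by (metis matrix_mul_assoc matrix_mul_rid that)
  have k1k: "k1 ** ?k = mat 1"
    unfolding k1_def f_factor_def R_def[symmetric] by (rule sand) (simp_all add: inv P R)
  have k2k: "k2 ** ?k = mat 1"
    unfolding k2_def f_factor_exchange[OF P zz] R_def[symmetric]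
    by (rule sand) (simp_all add: inv P R hermitian_projection_cnj)
  have kk1: "?k ** k1 = mat 1" using k1k by (simp add: matrix_left_right_inverse)
  have k12: "k1 = k2" using kk1 k2k by (metis matrix_mul_assoc matrix_mul_lid matrix_mul_rid)
  have "z \<notin> \<real> \<union> range (\<lambda>t::real. \<i> * of_real t)"
    using z False not_imaginary by (auto simp: complex_is_Real_iff)
  then have "?k \<in> simple_loops" using P unfolding simple_loops_def by blast
  moreover have "rfm_regular_below (g_factor (- cnj z) R)"
    using z by (auto intro!: g_factor_regular)
  moreover have "rfm_regular_below (g ** k1)"
    if g: "g \<in> rational_loops" "rfm_regular_below g" "rfm_eval g (cnj z) ** (mat 1 - P) = 0" for g
  proof (intro allI impI)
    fix b assume b: "Im b < 0"
    have reg: "rfm_regular g (cnj z)" "rfm_regular g (- z)" "rfm_regular g b" using g(2) z b by auto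
    show "rfm_regular (g ** k1) b"
    proof (cases "b = - z")
      case bz: True
      have "rfm_eval g (- z) = cnj_matrix (rfm_eval g (cnj z))"
        using loop_reality[OF g(1), of "cnj z"] reg by simp
      then have "rfm_eval g (- z) ** (mat 1 - cnj_matrix P) = cnj_matrix (rfm_eval g (cnj z) ** (mat 1 - P))"
        by (simp add: cnj_matrix_expand)
      also have "\<dots> = 0" by (simp add: g(3)) (simp add: vec_eq_iff)
      finally have "rfm_regular (g ** g_factor (- z) (cnj_matrix P)) b"
        unfolding bz using reg by (intro regular_mult_g_factor)
      moreover have "b \<noteq> cnj z" using False bz by (auto simp: complex_eq_iff)
      ultimately show ?thesis
        unfolding k12 k2_def matrix_mul_assoc by (rule rfm_regular_matrix_mult[OF _ g_factor_regular])
    next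
      case bz: False
      have "rfm_regular (g ** g_factor (cnj z) P) b"
        using g reg by (cases "b = cnj z") (auto intro: regular_mult_g_factor rfm_regular_matrix_mult g_factor_regular)
      then show ?thesis
        unfolding k1_def matrix_mul_assoc using bz by (rule rfm_regular_matrix_mult[OF _ g_factor_regular])
    qed
  qed
  ultimately show ?thesis
    using that[of ?k k1 "g_factor (- cnj z) R"] kk1 by (simp add: f_factor_def R_def)
qed

section \<open>Generation\<close>

lemma generate_cancel_simple:
  fixes g k kinv :: "ratfun^'n^'n"
  assumes "k \<in> simple_loops" "k ** kinv = mat 1"
  shows "g ** kinv \<in> generate Lambda_group simple_loops \<Longrightarrow> g \<in> generate Lambda_group simple_loops"
    and "g \<in> rational_loops \<Longrightarrow> g ** kinv \<in> rational_loops"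
    and "g ** k \<in> generate Lambda_group simple_loops \<Longrightarrow> g \<in> generate Lambda_group simple_loops"
proof -
  interpret group "Lambda_group :: (ratfun^'n^'n) monoid" by (rule group_Lambda_group)
  have k: "k \<in> carrier Lambda_group"
    using assms(1) simple_loops_subset by (auto simp: Lambda_group_def)
  then have "inv\<^bsub>Lambda_group\<^esub> k ** k = mat 1"
    using l_inv[OF k] by (simp add: Lambda_group_def)
  then have kinv: "kinv = inv\<^bsub>Lambda_group\<^esub> k"
    using assms(2) by (metis matrix_mul_assoc matrix_mul_lid matrix_mul_rid)
  have kg: "k \<in> generate Lambda_group simple_loops" "kinv \<in> generate Lambda_group simple_loops"
    using assms(1) by (auto simp: kinv intro: generate.intros)
  have mult: "a ** b \<in> generate Lambda_group simple_loops"
    if "a \<in> generate Lambda_group simple_loops" "b \<in> generate Lambda_group simple_loops" for a b :: "ratfun^'n^'n"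
    using generate.eng[OF that] by (simp add: Lambda_group_def)
  have kk: "kinv ** k = mat 1" using assms(2) by (simp add: matrix_left_right_inverse)
  show "g ** kinv \<in> generate Lambda_group simple_loops \<Longrightarrow> g \<in> generate Lambda_group simple_loops"
    using mult[of "g ** kinv" k] kg kk by (simp flip: matrix_mul_assoc)
  show "g ** k \<in> generate Lambda_group simple_loops \<Longrightarrow> g \<in> generate Lambda_group simple_loops"
    using mult[of "g ** k" kinv] kg assms(2) by (simp flip: matrix_mul_assoc)
  have "kinv \<in> rational_loops" using inv_closed[OF k] by (simp add: kinv Lambda_group_def)
  then show "g \<in> rational_loops \<Longrightarrow> g ** kinv \<in> rational_loops"
    by (rule rational_loops_mult[rotated])
qed

text \<open>
  Induction on the degree of a polynomial \<open>p\<close> divisible, over the lower half plane, by the determinant of \<open>g\<close>.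
  If \<open>g a\<close> is singular, then \<open>p\<close> vanishes at \<open>a\<close>. Dividing \<open>g\<close> by a simple element divides its determinant
  by a function that vanishes at \<open>a\<close>, so that \<open>p / (x - a)\<close> serves for the quotient. In this way neither
  the rank of the kernel nor the multiplicity of the zero has to be known.
\<close>
lemma generate_of_determinant:
  fixes g :: "ratfun^'n^'n"
  assumes "g \<in> rational_loops" "rfm_regular_below g" "p \<noteq> 0"
    and "\<And>b. Im b < 0 \<Longrightarrow> rf_regular (to_fract p / det g) b"
  shows "g \<in> generate Lambda_group simple_loops"
  using assms
proof (induction "degree p" arbitrary: p g rule: less_induct)
  case (less p g)
  show ?case
  proof (cases "\<exists>a. Im a < 0 \<and> det (rfm_eval g a) = 0")
    case False
    then have "g = mat 1" using less.prems by (intro loop_eq_1) auto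
    then show ?thesis using generate.one[of Lambda_group simple_loops] by (simp add: Lambda_group_def)
  next
    case True
    then obtain a where a: "Im a < 0" "det (rfm_eval g a) = 0" by blast
    have det0: "det g \<noteq> 0" using less.prems(1) by (simp add: rational_loops_def)
    have rega: "rfm_regular g a" using less.prems(2) a by blast
    have "to_fract p = to_fract p / det g * det g" using det0 by simp
    then have "poly p a = rf_eval (to_fract p / det g * det g) a" by simp
    also have "\<dots> = 0"
      using rf_mult[OF less.prems(4)[OF a(1)] rf_regular_det[OF rega]] a(2)
      by (simp add: rf_eval_det[OF rega])
    finally obtain p' where p': "p = [:- a, 1:] * p'" using poly_eq_0_iff_dvd by blast
    then have pp': "to_fract p = lin a * to_fract p'" by (simp only: to_fract_mult)
    have p'0: "p' \<noteq> 0" using p' less.prems(3) by auto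
    have deg: "degree p' < degree p"
      unfolding p' using p'0 by (subst degree_mult_eq) auto
    obtain P :: "complex^'n^'n" where P: "hermitian_projection P" "rfm_eval g a ** (mat 1 - P) = 0" "det P = 0"
        and real: "cnj_matrix (rfm_eval g a) = rfm_eval g a \<Longrightarrow> cnj_matrix P = P"
      using kernel_projection[OF a(2)] by blast
    have real': "cnj_matrix P = P" if "Re (cnj a) = 0"
    proof (rule real)
      have "- cnj a = a" using that by (simp add: complex_eq_iff)
      then show "cnj_matrix (rfm_eval g a) = rfm_eval g a"
        using loop_reality[OF less.prems(1) rega] rega by simp
    qed
    have "Im (cnj a) > 0" using a(1) by simp
    then obtain k kinv m where k: "k \<in> simple_loops" "k ** kinv = mat 1" "k = m ** g_factor (cnj a) P"
        "rfm_regular_below m"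
      and kinv: "\<forall>g\<in>rational_loops. rfm_regular_below g \<longrightarrow> rfm_eval g (cnj (cnj a)) ** (mat 1 - P) = 0
        \<longrightarrow> rfm_regular_below (g ** kinv)"
      using P(1) real' by (rule simple_loop_with_factor)
    define h where "h = g ** kinv"
    have g: "g = h ** k"
    proof -
      have "kinv ** k = mat 1" using k(2) matrix_left_right_inverse by blast
      then show ?thesis by (simp add: h_def flip: matrix_mul_assoc)
    qed
    have det: "det g = det h * (det m * det (g_factor (cnj a) P))"
      by (simp add: g k(3) det_mul)
    have "h \<in> generate Lambda_group simple_loops"
    proof (rule less.hyps[OF deg])
      show "h \<in> rational_loops" unfolding h_def by (rule generate_cancel_simple(2)[OF k(1,2) less.prems(1)])
      show "rfm_regular_below h" 
        using kinv less.prems(1,2) P(2) by (simp add: h_def)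
      fix b assume b: "Im b < 0"
      have "to_fract p' / det h = to_fract p / det g * det m * (det (g_factor (cnj a) P) / lin (cnj (cnj a)))"
        using det0 unfolding det by (simp add: pp' field_simps)
      moreover have "rf_regular (det (g_factor (cnj a) P) / lin (cnj (cnj a))) b"
        using a b P(3) by (intro det_g_factor_divisible) (auto simp: complex_eq_iff)
      moreover have "rf_regular (det m) b" using k(4) b by (simp add: rf_regular_det)
      ultimately show "rf_regular (to_fract p' / det h) b"
        using less.prems(4)[OF b] by (simp only: rf_regular_mult)
    qed (rule p'0)
    then show ?thesis unfolding h_def by (rule generate_cancel_simple(1)[OF k(1,2)])
  qed
qed

text \<open>
  Induction on the degree of a polynomial \<open>q\<close> that clears the poles of \<open>g\<close> in the lower half plane. At a zero
  \<open>a\<close> of \<open>q\<close> in the lower half plane, multiply \<open>g\<close> with the simple element for projection zero: its factor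
  \<open>g_factor (cnj a) 0\<close> is the scalar \<open>(x - a) / (x - cnj a)\<close>, so that \<open>q / (x - a)\<close> serves for the product.
\<close>
lemma generate_of_denominator:
  fixes g :: "ratfun^'n^'n"
  assumes "g \<in> rational_loops" "q \<noteq> 0"
    and "\<And>i j b. Im b < 0 \<Longrightarrow> rf_regular (to_fract q * g $ i $ j) b"
  shows "g \<in> generate Lambda_group simple_loops"
  using assms
proof (induction "degree q" arbitrary: q g rule: less_induct)
  case (less q g)
  show ?case
  proof (cases "\<exists>a. Im a < 0 \<and> poly q a = 0")
    case False
    have reg: "rfm_regular_below g"
      unfolding rfm_regular_def
    proof (intro allI impI)
      fix b i j assume b: "Im b < 0"
      have "g $ i $ j = to_fract q * g $ i $ j * (1 / to_fract q)"
        using less.prems(2) by simp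
      moreover have "rf_regular (1 / to_fract q) b" using False b by (intro rf_inverse_regular) auto
      ultimately show "rf_regular (g $ i $ j) b" using less.prems(3)[OF b] rf_regular_mult by metis
    qed
    have d0: "det g \<noteq> 0" using less.prems(1) by (simp add: rational_loops_def)
    have dg: "det g = to_fract (rf_num (det g)) / to_fract (rf_den (det g))"
      by (simp add: to_fract_def)
    show ?thesis
    proof (rule generate_of_determinant[OF less.prems(1) reg])
      show "rf_num (det g) \<noteq> 0" using dg d0 by (metis div_0 to_fract_0)
      have "to_fract (rf_num (det g)) / det g = to_fract (rf_den (det g))"
        using d0 by (subst (2) dg) (metis dg divide_divide_eq_right divide_eq_0_iff nonzero_mult_div_cancel_left)
      then show "rf_regular (to_fract (rf_num (det g)) / det g) b" for b by simp
    qed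
  next
    case True
    then obtain a where a: "Im a < 0" "poly q a = 0" by blast
    then obtain q' where q': "q = [:- a, 1:] * q'" using poly_eq_0_iff_dvd by blast
    then have qq': "to_fract q = lin a * to_fract q'" by (simp only: to_fract_mult)
    have q'0: "q' \<noteq> 0" using q' less.prems(2) by auto
    have deg: "degree q' < degree q"
      unfolding q' using q'0 by (subst degree_mult_eq) auto
    define z where "z = cnj a"
    have z: "Im z > 0" using a by (simp add: z_def)
    obtain k kinv m where k: "k \<in> simple_loops" "k ** kinv = mat 1" "k = m ** g_factor z (0 :: complex^'n^'n)"
        "rfm_regular_below m"
      using z hermitian_projection_0 cnj_matrix_0 by (rule simple_loop_with_factor)
    have "g ** k \<in> generate Lambda_group simple_loops"
    proof (rule less.hyps[OF deg])
      show "g ** k \<in> rational_loops"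
        using k(1) less.prems(1) simple_loops_subset by (intro rational_loops_mult) auto
      fix i j b assume b: "Im b < 0"
      have "(g ** k) $ i $ j = (\<Sum>l\<in>UNIV. (g ** m) $ i $ l * g_factor z (0 :: complex^'n^'n) $ l $ j)"
        unfolding k(3) matrix_mul_assoc by (simp add: matrix_matrix_mult_def)
      also have "\<dots> = (\<Sum>l\<in>UNIV. if l = j then (g ** m) $ i $ j * (lin a * (1 / lin z)) else 0)"
        unfolding g_factor_def blaschke_lin by (intro sum.cong refl) (auto simp: mat_def rf_const_01 z_def)
      also have "\<dots> = (\<Sum>l\<in>UNIV. g $ i $ l * m $ l $ j) * (lin a * (1 / lin z))"
        by (simp add: matrix_matrix_mult_def)
      finally have "to_fract q' * (g ** k) $ i $ j = (\<Sum>l\<in>UNIV. (to_fract q * g $ i $ l * m $ l $ j)) * (1 / lin z)"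
        by (simp add: qq' sum_distrib_left sum_distrib_right sum_divide_distrib mult_ac)
      moreover have "rf_regular (\<Sum>l\<in>UNIV. (to_fract q * g $ i $ l * m $ l $ j)) b"
        using less.prems(3)[OF b] k(4) b by (simp add: rf_sum rf_mult rfm_regular_def)
      moreover have "rf_regular (1 / lin z) b" using z b by (intro rf_inverse_lin_regular) auto
      ultimately show "rf_regular (to_fract q' * (g ** k) $ i $ j) b"
        by (simp only: rf_regular_mult)
    qed (rule q'0)
    then show ?thesis by (rule generate_cancel_simple(3)[OF k(1,2)])
  qed
qed

lemma common_denominator:
  fixes g :: "ratfun^'n^'n"
  obtains q where "q \<noteq> 0" "\<And>i j b. rf_regular (to_fract q * g $ i $ j) b"
proof -
  define q where "q = (\<Prod>(i, j)\<in>UNIV. rf_den (g $ i $ j))"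
  have "rf_regular (to_fract q * g $ i $ j) b" for i j b
  proof -
    have "rf_den (g $ i $ j) dvd q"
      unfolding q_def using dvd_prodI[of UNIV "(i, j)" "\<lambda>(i, j). rf_den (g $ i $ j)"] by simp
    then obtain r where r: "q = rf_den (g $ i $ j) * r" by (rule dvdE)
    have "g $ i $ j = to_fract (rf_num (g $ i $ j)) / to_fract (rf_den (g $ i $ j))"
      by (simp add: to_fract_def)
    then have "to_fract (rf_den (g $ i $ j)) * g $ i $ j = to_fract (rf_num (g $ i $ j))"
      by (metis nonzero_mult_div_cancel_left rf_den_nonzero times_divide_eq_right to_fract_eq_0_iff)
    then have "to_fract q * g $ i $ j = to_fract (r * rf_num (g $ i $ j))"
      by (simp add: r mult_ac)
    then show ?thesis by (simp only: rf_eval_to_fract)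
  qed
  moreover have "q \<noteq> 0" by (auto simp: q_def)
  ultimately show ?thesis using that by blast
qed

theorem theorem3p6:
  shows "generate (Lambda_group :: (complex poly fract ^ 'n ^ 'n) monoid)
           ({g_factor (\<i> * of_real s) P | s P.
               s \<noteq> 0 \<and> hermitian_projection P \<and> cnj_matrix P = P} \<union>
            {f_factor z P | z P.
               z \<notin> \<real> \<union> range (\<lambda>t::real. \<i> * of_real t) \<and> hermitian_projection P})
         = carrier Lambda_group"
proof -
  interpret group "Lambda_group :: (ratfun^'n^'n) monoid" by (rule group_Lambda_group)
  have carrier: "carrier Lambda_group = (rational_loops :: (ratfun^'n^'n) set)"
    by (simp add: Lambda_group_def)
  have "generate Lambda_group simple_loops = (carrier Lambda_group :: (ratfun^'n^'n) set)"
  proof (rule equalityI)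
    show "generate Lambda_group simple_loops \<subseteq> (carrier Lambda_group :: (ratfun^'n^'n) set)"
      by (rule generate_incl) (simp add: carrier simple_loops_subset)
    show "(carrier Lambda_group :: (ratfun^'n^'n) set) \<subseteq> generate Lambda_group simple_loops"
    proof
      fix g :: "ratfun^'n^'n"
      assume "g \<in> carrier Lambda_group"
      moreover obtain q where "q \<noteq> 0" "\<And>i j b. rf_regular (to_fract q * g $ i $ j) b"
        using common_denominator[of g] by blast
      ultimately show "g \<in> generate Lambda_group simple_loops"
        unfolding carrier by (intro generate_of_denominator)
    qed
  qed
  then show ?thesis unfolding simple_loops_def .
qed

end
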